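(* Let $F$ be a non-dyadic non-archimedean local field and $n\ge 2$ an integer. Let $M$ be an integral $\mathcal{O}_F$-lattice of rank $n+1$ or $n+2$. Then $M$ is $n$-ADC if and only if $M$ is $\mathcal{O}_F$-maximal.
   Context: An integral $\mathcal{O}_F$-lattice is a finitely generated $\mathcal{O}_F$-submodule of a non-degenerate quadratic space over $F$ with norm ideal $\mathfrak{n}(M)\subseteq\mathcal{O}_F$. $M$ is $n$-ADC if for every integral $\mathcal{O}_F$-lattice $N$ of rank $n$ such that $FM$ represents $FN$, $M$ represents $N$. $M$ is $\mathcal{O}_F$-maximal if $\mathfrak{n}(M)\subseteq\mathcal{O}_F$ and $M$ contains every lattice on $FM$ whose norm is contained in $\mathcal{O}_F$. Non-dyadic means $2\in\mathcal{O}_F^\times$.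
   Formalization: O_F-maximal is taken in the standard sense: no strictly larger lattice on FM containing M has norm in O_F (the literal "contains every such lattice" fails for isotropic FM, e.g. H ⊥ <1> over Q_3); for integral lattices, M and the tested N, the spanned space itself is required non-degenerate. *)

theory Defs
  imports Complex_Main "HOL-Library.Function_Algebras"
begin

section \<open>Non-archimedean local fields\<close>

text \<open>
  A valuation is a map \<open>v\<close> into the integers that is only meaningful at nonzero arguments
  (mathematically \<open>v 0 = \<infinity>\<close>); the value \<open>v 0\<close> is never used.
\<close>

definition val_ge :: "('f::field \<Rightarrow> int) \<Rightarrow> int \<Rightarrow> 'f \<Rightarrow> bool" where
  "val_ge v k x \<longleftrightarrow> x = 0 \<or> k \<le> v x"

definition ring_of_integers :: "('f::field \<Rightarrow> int) \<Rightarrow> 'f set" where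
  "ring_of_integers v = {x. val_ge v 0 x}"

definition maximal_ideal :: "('f::field \<Rightarrow> int) \<Rightarrow> 'f set" where
  "maximal_ideal v = {x. val_ge v 1 x}"

definition integer_units :: "('f::field \<Rightarrow> int) \<Rightarrow> 'f set" where
  "integer_units v = {x \<in> ring_of_integers v. \<exists>y \<in> ring_of_integers v. x * y = 1}"

definition residue_field :: "('f::field \<Rightarrow> int) \<Rightarrow> 'f set set" where
  "residue_field v =
     ring_of_integers v //
       {(x, y). x \<in> ring_of_integers v \<and> y \<in> ring_of_integers v \<and> x - y \<in> maximal_ideal v}"

text \<open>
  Complete with respect to a normalized discrete valuation, with finite residue field.
  No assumption is made on the characteristic.
\<close>

locale nonarch_local_field =
  fixes v :: "'f::field \<Rightarrow> int"
  assumes val_mult: "x \<noteq> 0 \<Longrightarrow> y \<noteq> 0 \<Longrightarrow> v (x * y) = v x + v y"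
    and val_add: "x \<noteq> 0 \<Longrightarrow> y \<noteq> 0 \<Longrightarrow> x + y \<noteq> 0 \<Longrightarrow> min (v x) (v y) \<le> v (x + y)"
    and uniformizer: "\<exists>x. x \<noteq> 0 \<and> v x = 1"
    and finite_residue_field: "finite (residue_field v)"
    and complete:
      "(\<And>k. \<exists>N. \<forall>i\<ge>N. \<forall>j\<ge>N. val_ge v k (X i - X j)) \<Longrightarrow>
         \<exists>L. \<forall>k. \<exists>N. \<forall>i\<ge>N. val_ge v k ((X :: nat \<Rightarrow> 'f) i - L)"

definition non_dyadic :: "('f::field \<Rightarrow> int) \<Rightarrow> bool" where
  "non_dyadic v \<longleftrightarrow> 2 \<in> integer_units v"


section \<open>Quadratic spaces\<close>

text \<open>
  A quadratic space over \<open>'f\<close> is a finite-dimensional subspace \<open>V\<close> of an ambient vector space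
  \<open>'v\<close> (with scalar multiplication \<open>scale\<close>) together with a form \<open>B\<close> that is symmetric and
  bilinear on \<open>V\<close>; the values of \<open>B\<close> outside \<open>V\<close> are irrelevant. The quadratic form is
  \<open>Q x = B x x\<close>.
\<close>

definition quadratic_space ::
  "('f::field \<Rightarrow> 'v::ab_group_add \<Rightarrow> 'v) \<Rightarrow> ('v \<Rightarrow> 'v \<Rightarrow> 'f) \<Rightarrow> 'v set \<Rightarrow> bool" where
  "quadratic_space scale B V \<longleftrightarrow>
     vector_space scale \<and>
     (\<exists>S. finite S \<and> V = module.span scale S) \<and>
     (\<forall>x\<in>V. \<forall>y\<in>V. B x y = B y x) \<and>
     (\<forall>x\<in>V. \<forall>y\<in>V. \<forall>z\<in>V. B (x + y) z = B x z + B y z) \<and>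
     (\<forall>c. \<forall>x\<in>V. \<forall>y\<in>V. B (scale c x) y = c * B x y)"

definition nondegenerate :: "('v::ab_group_add \<Rightarrow> 'v \<Rightarrow> 'f::field) \<Rightarrow> 'v set \<Rightarrow> bool" where
  "nondegenerate B V \<longleftrightarrow> (\<forall>x\<in>V. (\<forall>y\<in>V. B x y = 0) \<longrightarrow> x = 0)"

text \<open>
  Representations of quadratic spaces, respectively lattices. Every linear map on a subspace is the
  restriction of a linear map on the ambient space, so \<open>\<sigma>\<close> may be taken total.
\<close>

definition space_represents ::
  "('f::field \<Rightarrow> 'v::ab_group_add \<Rightarrow> 'v) \<Rightarrow> ('v \<Rightarrow> 'v \<Rightarrow> 'f) \<Rightarrow> 'v set \<Rightarrow>
   ('f \<Rightarrow> 'w::ab_group_add \<Rightarrow> 'w) \<Rightarrow> ('w \<Rightarrow> 'w \<Rightarrow> 'f) \<Rightarrow> 'w set \<Rightarrow> bool" where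
  "space_represents scaleV B V scaleW C W \<longleftrightarrow>
     (\<exists>\<sigma>. Vector_Spaces.linear scaleW scaleV \<sigma> \<and> \<sigma> ` W \<subseteq> V \<and>
          (\<forall>x\<in>W. B (\<sigma> x) (\<sigma> x) = C x x))"

definition lattice_represents ::
  "('f::field \<Rightarrow> 'v::ab_group_add \<Rightarrow> 'v) \<Rightarrow> ('v \<Rightarrow> 'v \<Rightarrow> 'f) \<Rightarrow> 'v set \<Rightarrow>
   ('f \<Rightarrow> 'w::ab_group_add \<Rightarrow> 'w) \<Rightarrow> ('w \<Rightarrow> 'w \<Rightarrow> 'f) \<Rightarrow> 'w set \<Rightarrow> bool" where
  "lattice_represents scaleV B M scaleW C N \<longleftrightarrow>
     (\<exists>\<sigma>. Vector_Spaces.linear scaleW scaleV \<sigma> \<and> \<sigma> ` module.span scaleW N \<subseteq> module.span scaleV M \<and>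
          (\<forall>x\<in>module.span scaleW N. B (\<sigma> x) (\<sigma> x) = C x x) \<and> \<sigma> ` N \<subseteq> M)"


section \<open>Lattices\<close>

definition integer_span ::
  "('f::field \<Rightarrow> int) \<Rightarrow> ('f \<Rightarrow> 'v::ab_group_add \<Rightarrow> 'v) \<Rightarrow> 'v set \<Rightarrow> 'v set" where
  "integer_span v scale S =
     {\<Sum>x\<in>T. scale (c x) x | T c. finite T \<and> T \<subseteq> S \<and> (\<forall>x\<in>T. c x \<in> ring_of_integers v)}"

definition lattice ::
  "('f::field \<Rightarrow> int) \<Rightarrow> ('f \<Rightarrow> 'v::ab_group_add \<Rightarrow> 'v) \<Rightarrow> 'v set \<Rightarrow> bool" where
  "lattice v scale M \<longleftrightarrow> (\<exists>S. finite S \<and> M = integer_span v scale S)"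

definition norm_ideal ::
  "('f::field \<Rightarrow> int) \<Rightarrow> ('v::ab_group_add \<Rightarrow> 'v \<Rightarrow> 'f) \<Rightarrow> 'v set \<Rightarrow> 'f set" where
  "norm_ideal v B M = integer_span v (*) {B x x | x. x \<in> M}"

text \<open>The space \<open>FM\<close> spanned by \<open>M\<close> is \<open>module.span scale M\<close>, and the rank of \<open>M\<close> is its dimension.\<close>

definition lattice_rank ::
  "('f::field \<Rightarrow> 'v::ab_group_add \<Rightarrow> 'v) \<Rightarrow> 'v set \<Rightarrow> nat" where
  "lattice_rank scale M = vector_space.dim scale (module.span scale M)"

definition integral_lattice ::
  "('f::field \<Rightarrow> int) \<Rightarrow> ('f \<Rightarrow> 'v::ab_group_add \<Rightarrow> 'v) \<Rightarrow> ('v \<Rightarrow> 'v \<Rightarrow> 'f) \<Rightarrow> 'v set \<Rightarrow> bool" where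
  "integral_lattice v scale B M \<longleftrightarrow>
     quadratic_space scale B (module.span scale M) \<and> nondegenerate B (module.span scale M) \<and>
     lattice v scale M \<and> norm_ideal v B M \<subseteq> ring_of_integers v"

text \<open>Maximality is with respect to inclusion among the lattices of integral norm on \<open>FM\<close>.\<close>

definition maximal_lattice ::
  "('f::field \<Rightarrow> int) \<Rightarrow> ('f \<Rightarrow> 'v::ab_group_add \<Rightarrow> 'v) \<Rightarrow> ('v \<Rightarrow> 'v \<Rightarrow> 'f) \<Rightarrow> 'v set \<Rightarrow> bool" where
  "maximal_lattice v scale B M \<longleftrightarrow>
     norm_ideal v B M \<subseteq> ring_of_integers v \<and>
     (\<forall>K. lattice v scale K \<and> module.span scale K = module.span scale M \<and>
          norm_ideal v B K \<subseteq> ring_of_integers v \<and> M \<subseteq> K \<longrightarrow> K = M)"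

text \<open>
  A definition cannot quantify over all types of ambient vector spaces. The lattices \<open>N\<close> tested in
  the definition of \<open>n\<close>-ADC therefore live in the space of all sequences over the field, into which
  every finite-dimensional space embeds. Lemma \<open>n_ADC_represents\<close> below shows that this loses nothing:
  the defining property then holds for lattices in arbitrary ambient vector spaces.
\<close>

definition seq_scale :: "'f::field \<Rightarrow> (nat \<Rightarrow> 'f) \<Rightarrow> (nat \<Rightarrow> 'f)" where
  "seq_scale c x = (\<lambda>i. c * x i)"

definition n_ADC ::
  "('f::field \<Rightarrow> int) \<Rightarrow> nat \<Rightarrow> ('f \<Rightarrow> 'v::ab_group_add \<Rightarrow> 'v) \<Rightarrow> ('v \<Rightarrow> 'v \<Rightarrow> 'f) \<Rightarrow> 'v set \<Rightarrow> bool"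
  where
  "n_ADC v n scale B M \<longleftrightarrow>
     (\<forall>C N. integral_lattice v seq_scale C N \<and> lattice_rank seq_scale N = n \<and>
            space_represents scale B (module.span scale M) seq_scale C (module.span seq_scale N) \<longrightarrow>
            lattice_represents scale B M seq_scale C N)"


section \<open>Independence of the ambient space\<close>

lemma vector_space_seq_scale: "vector_space (seq_scale :: 'f::field \<Rightarrow> _)"
  by unfold_locales (auto simp: seq_scale_def fun_eq_iff algebra_simps)

lemma sum_fun_apply: "(\<Sum>a\<in>A. g a) i = (\<Sum>a\<in>A. g a i)"
  for g :: "'a \<Rightarrow> 'b \<Rightarrow> 'c::comm_monoid_add"
  by (induction A rule: infinite_finite_induct) auto

lemma integer_span_inj_image:
  assumes "Vector_Spaces.linear s1 s2 f" and inj: "inj_on f S"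
  shows "integer_span v s2 (f ` S) = f ` integer_span v s1 S"
proof -
  interpret f: Vector_Spaces.linear s1 s2 f by fact
  have *: "f (\<Sum>x\<in>T. s1 (c x) x) = (\<Sum>x\<in>T. s2 (c x) (f x))" for c T
    by (simp add: f.sum f.scale)
  show ?thesis
  proof (intro equalityI subsetI)
    fix y assume "y \<in> integer_span v s2 (f ` S)"
    then obtain T c where T: "finite T" "T \<subseteq> f ` S" "\<forall>x\<in>T. c x \<in> ring_of_integers v"
      and y: "y = (\<Sum>x\<in>T. s2 (c x) x)" unfolding integer_span_def by blast
    obtain T' where T': "T' \<subseteq> S" "finite T'" "T = f ` T'"
      using T by (meson finite_subset_image)
    have "inj_on f T'" using inj T'(1) inj_on_subset by blast
    then have "y = f (\<Sum>x\<in>T'. s1 (c (f x)) x)"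
      unfolding * y T'(3) by (simp add: sum.reindex)
    then show "y \<in> f ` integer_span v s1 S"
      using T T' unfolding integer_span_def by (auto intro!: imageI exI[of _ T'] exI[of _ "\<lambda>x. c (f x)"])
  next
    fix y assume "y \<in> f ` integer_span v s1 S"
    then obtain T c where T: "finite T" "T \<subseteq> S" "\<forall>x\<in>T. c x \<in> ring_of_integers v"
      and y: "y = (\<Sum>x\<in>T. s2 (c x) (f x))" unfolding integer_span_def using * by auto
    have i: "inj_on f T" using inj T(2) inj_on_subset by blast
    have "y = (\<Sum>x\<in>f ` T. s2 (c (the_inv_into T f x)) x)"
      unfolding y by (simp add: sum.reindex[OF i] the_inv_into_f_f[OF i])
    then show "y \<in> integer_span v s2 (f ` S)"
      using T unfolding integer_span_def
      by (auto intro!: exI[of _ "f ` T"] exI[of _ "\<lambda>x. c (the_inv_into T f x)"]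
          simp: the_inv_into_f_f[OF i])
  qed
qed

lemma embed_seq:
  fixes scale :: "'f::field \<Rightarrow> 'w::ab_group_add \<Rightarrow> 'w"
  assumes "vector_space scale" and "finite S"
  obtains f g where "Vector_Spaces.linear scale seq_scale f" "Vector_Spaces.linear seq_scale scale g"
    "\<forall>x\<in>module.span scale S. g (f x) = x"
proof -
  interpret W: vector_space scale by fact
  interpret F: vector_space "seq_scale :: 'f \<Rightarrow> _" by (rule vector_space_seq_scale)
  interpret WF: vector_space_pair scale "seq_scale :: 'f \<Rightarrow> _" ..
  interpret FW: vector_space_pair "seq_scale :: 'f \<Rightarrow> _" scale ..
  obtain b where b: "b \<subseteq> S" "W.independent b" "S \<subseteq> W.span b"
    using W.maximal_independent_subset[of S] by blast
  have bs: "W.span b = W.span S"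
    by (rule equalityI) (use b W.span_mono W.span_minimal[OF b(3) W.subspace_span] in auto)
  have "finite b" using b(1) assms(2) finite_subset by blast
  then obtain h :: "'w \<Rightarrow> nat" where h: "inj_on h b"
    using finite_imp_inj_to_nat_seg by blast
  define e :: "'w \<Rightarrow> nat \<Rightarrow> 'f" where "e x = (\<lambda>i. if i = h x then 1 else 0)" for x
  obtain f where f: "Vector_Spaces.linear scale seq_scale f" "\<forall>x\<in>b. f x = e x"
    using WF.linear_independent_extend[OF b(2)] by blast
  interpret f: Vector_Spaces.linear scale "seq_scale :: 'f \<Rightarrow> _" f by fact
  have "inj_on f (W.span b)"
  proof (subst f.inj_on_iff_eq_0[OF W.subspace_span], intro ballI impI)
    fix x assume x: "x \<in> W.span b" and 0: "f x = 0"
    obtain u where u: "x = (\<Sum>a\<in>b. scale (u a) a)"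
      using x W.span_finite[OF \<open>finite b\<close>] by auto
    have u0: "u a = 0" if "a \<in> b" for a
    proof -
      have "f x (h a) = (\<Sum>a'\<in>b. seq_scale (u a') (e a') (h a))"
        using f(2) by (simp add: u f.sum f.scale sum_fun_apply)
      also have "\<dots> = (\<Sum>a'\<in>b. if a' = a then u a else 0)"
        using h that by (intro sum.cong) (auto simp: seq_scale_def e_def inj_on_def)
      also have "\<dots> = u a" using that \<open>finite b\<close> by simp
      finally show ?thesis using 0 by simp
    qed
    then show "x = 0" unfolding u by simp
  qed
  then obtain g where "Vector_Spaces.linear seq_scale scale g" "\<forall>x\<in>W.span b. g (f x) = x"
    using WF.linear_inj_on_left_inverse[OF f(1)] by blast
  then show thesis using that f(1) bs by simp
qed

lemma n_ADC_represents:
  fixes scaleW :: "'f::field \<Rightarrow> 'w::ab_group_add \<Rightarrow> 'w"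
  assumes adc: "n_ADC v n scale B M"
    and N: "integral_lattice v scaleW C N" and rank: "lattice_rank scaleW N = n"
    and rep: "space_represents scale B (module.span scale M) scaleW C (module.span scaleW N)"
  shows "lattice_represents scale B M scaleW C N"
proof -
  have qs: "quadratic_space scaleW C (module.span scaleW N)"
    and nd: "nondegenerate C (module.span scaleW N)"
    using N by (auto simp: integral_lattice_def)
  obtain S where S: "finite S" "N = integer_span v scaleW S"
    using N by (auto simp: integral_lattice_def lattice_def)
  obtain S' where S': "finite S'" "module.span scaleW N = module.span scaleW S'"
    using qs by (auto simp: quadratic_space_def)
  interpret W: vector_space scaleW using qs by (simp add: quadratic_space_def)
  interpret F: vector_space "seq_scale :: 'f \<Rightarrow> _" by (rule vector_space_seq_scale)
  interpret WF: vector_space_pair scaleW "seq_scale :: 'f \<Rightarrow> _" ..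
  let ?U = "W.span (S \<union> S')"
  obtain f g where lf: "Vector_Spaces.linear scaleW seq_scale f"
    and lg: "Vector_Spaces.linear seq_scale scaleW g" and gf: "\<forall>x\<in>?U. g (f x) = x"
    using embed_seq[OF W.vector_space_axioms, of "S \<union> S'"] S S' by auto
  interpret f: Vector_Spaces.linear scaleW "seq_scale :: 'f \<Rightarrow> _" f by fact
  interpret g: Vector_Spaces.linear "seq_scale :: 'f \<Rightarrow> _" scaleW g by fact
  have sub: "W.span N \<subseteq> ?U" using S' W.span_mono[of S' "S \<union> S'"] by simp
  then have gfN: "g (f x) = x" if "x \<in> W.span N" for x using gf that by blast
  then have injN: "inj_on f (W.span N)" by (metis inj_onI)
  have injS: "inj_on f S" using gf W.span_base by (metis UnI1 inj_onI)
  have N': "f ` N = integer_span v seq_scale (f ` S)"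
    using integer_span_inj_image[OF lf injS] S by simp
  have span': "F.span (f ` N) = f ` W.span N" by (rule f.span_image)
  define C' where "C' x y = C (g x) (g y)" for x y
  have C': "C' (f x) (f y) = C x y" if "x \<in> W.span N" "y \<in> W.span N" for x y
    using gfN that by (simp add: C'_def)
  have "quadratic_space seq_scale C' (F.span (f ` N))"
    unfolding quadratic_space_def
  proof (intro conjI)
    show "vector_space (seq_scale :: 'f \<Rightarrow> _)" by (rule vector_space_seq_scale)
    show "\<exists>S. finite S \<and> F.span (f ` N) = F.span S"
      using S' by (metis finite_imageI f.span_image)
    show "\<forall>x\<in>F.span (f ` N). \<forall>y\<in>F.span (f ` N). C' x y = C' y x"
      using qs by (auto simp: span' C' quadratic_space_def)
    show "\<forall>x\<in>F.span (f ` N). \<forall>y\<in>F.span (f ` N). \<forall>z\<in>F.span (f ` N). C' (x + y) z = C' x z + C' y z"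
      using qs by (auto simp: span' C' quadratic_space_def W.span_add simp flip: f.add)
    show "\<forall>c. \<forall>x\<in>F.span (f ` N). \<forall>y\<in>F.span (f ` N). C' (seq_scale c x) y = c * C' x y"
      using qs by (auto simp: span' C' quadratic_space_def W.span_scale simp flip: f.scale)
  qed
  moreover have "nondegenerate C' (F.span (f ` N))"
    using nd by (auto simp: nondegenerate_def span' C' f.zero)
  moreover have "lattice v seq_scale (f ` N)"
    unfolding lattice_def using N' S(1) by blast
  moreover have "{C' x x | x. x \<in> f ` N} = {C x x | x. x \<in> N}"
    using C' W.span_base[of _ N] by (auto simp: image_iff) metis
  then have "norm_ideal v C' (f ` N) \<subseteq> ring_of_integers v"
    using N by (simp add: norm_ideal_def integral_lattice_def)
  ultimately have il: "integral_lattice v seq_scale C' (f ` N)"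
    by (simp add: integral_lattice_def)
  have rk: "lattice_rank seq_scale (f ` N) = n"
  proof -
    obtain b where b: "b \<subseteq> N" "W.independent b" "N \<subseteq> W.span b"
    using W.maximal_independent_subset[of N] by blast
  have bs: "W.span b = W.span N"
    by (rule equalityI) (use b W.span_mono W.span_minimal[OF b(3) W.subspace_span] in auto)
    have inj: "inj_on f (W.span b)" using injN bs by simp
    have "F.independent (f ` b)"
      using f.independent_inj_on_image[OF b(2) inj] by simp
    moreover have "F.span (f ` b) = F.span (f ` N)"
      using bs by (simp add: f.span_image)
    moreover have "card (f ` b) = card b"
      using inj W.span_superset by (meson card_image inj_on_subset)
    ultimately have "F.dim (f ` N) = card b"
      by (metis F.dim_eq_card)
    moreover have "W.dim N = card b" using b(2) bs by (metis W.dim_eq_card)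
    ultimately show ?thesis using rank by (simp add: lattice_rank_def)
  qed
  obtain \<sigma> where \<sigma>: "Vector_Spaces.linear scaleW scale \<sigma>" "\<sigma> ` W.span N \<subseteq> module.span scale M"
    "\<forall>x\<in>W.span N. B (\<sigma> x) (\<sigma> x) = C x x"
    using rep by (auto simp: space_represents_def)
  have "space_represents scale B (module.span scale M) seq_scale C' (F.span (f ` N))"
    unfolding space_represents_def
  proof (intro exI conjI)
    show "Vector_Spaces.linear seq_scale scale (\<sigma> \<circ> g)"
      using Vector_Spaces.linear_compose[OF lg \<sigma>(1)] .
  qed (use \<sigma> gfN C' in \<open>auto simp: span'\<close>)
  with adc il rk have "lattice_represents scale B M seq_scale C' (f ` N)"
    unfolding n_ADC_def by blast
  then obtain \<tau> where \<tau>: "Vector_Spaces.linear seq_scale scale \<tau>"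
    "\<tau> ` F.span (f ` N) \<subseteq> module.span scale M"
    "\<forall>x\<in>F.span (f ` N). B (\<tau> x) (\<tau> x) = C' x x" "\<tau> ` f ` N \<subseteq> M"
    by (auto simp: lattice_represents_def)
  show ?thesis
    unfolding lattice_represents_def
  proof (intro exI conjI)
    show "Vector_Spaces.linear scaleW scale (\<tau> \<circ> f)"
      using Vector_Spaces.linear_compose[OF lf \<tau>(1)] .
  qed (use \<tau> C' in \<open>auto simp: span'\<close>)
qed

end

theory Submission
  imports Defs
begin

text \<open>
  \<^bold>\<open>Maximal implies ADC.\<close> Let \<open>M\<close> be maximal and \<open>N\<close> integral in \<open>FM\<close>. If \<open>B(N, M)\<close> is integral, then
  \<open>N \<subseteq> M\<close> by maximality. Otherwise a pair \<open>x \<in> N\<close>, \<open>y \<in> M\<close> with \<open>\<beta> = B(x, y)\<close> of least valuation gives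
  unimodular hyperbolic planes \<open>\<langle>x, y/\<beta>\<rangle>\<close> and \<open>\<langle>x/\<beta>, y\<rangle>\<close> on the same subspace, which split
  \<open>N + \<O> y/\<beta>\<close> and \<open>M\<close>. They are isometric, and induction on the dimension moves \<open>N\<close> into \<open>M\<close>.

  \<^bold>\<open>ADC implies maximal.\<close> Let \<open>K \<supseteq> M\<close> be a maximal integral submodule. A maximal orthogonal set of
  vectors of unit norm in \<open>K\<close> leaves an orthogonal complement that is anisotropic modulo scaling,
  hence of rank at most 2, so there are \<open>n - 1\<close> such vectors \<open>X\<close>, and by ADC one may take \<open>X \<subseteq> M\<close>.
  Reflections show that sets of vectors with equal unit norms in \<open>M\<close> are conjugate under \<open>O(M)\<close>, so the
  orthogonal complement of \<open>X\<close> in \<open>M\<close> represents every nonzero integer that the complement of \<open>X\<close>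
  in \<open>FM\<close> represents. Testing with units and with prime elements forces \<open>M = K\<close>.
\<close>

section \<open>Non-dyadic local fields\<close>

locale nondyadic_local_field = nonarch_local_field v for v :: "'f::field \<Rightarrow> int" +
  assumes non_dyadic: "non_dyadic v"
begin

text \<open>\<open>I k\<close> is membership in the k-th (fractional) power of the maximal ideal. It
  always holds at 0, so the meaningless value \<open>v 0\<close> stays out of the
  computations.\<close>

abbreviation I :: "int \<Rightarrow> 'f \<Rightarrow> bool" where "I \<equiv> val_ge v"

definition val_unit :: "'f \<Rightarrow> bool" where "val_unit a \<longleftrightarrow> a \<noteq> 0 \<and> v a = 0"

lemma val_1 [simp]: "v 1 = 0"
  using val_mult[of 1 1] by simp

lemma val_minus [simp]: "v (- x) = v x"
proof (cases "x = 0")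
  case False
  have "v (-1) = 0" using val_mult[of "-1" "-1"] by simp
  then show ?thesis using val_mult[of "-1" x] False by simp
qed simp

lemma val_inverse: "x \<noteq> 0 \<Longrightarrow> v (inverse x) = - v x"
  using val_mult[of x "inverse x"] by simp

lemma I_0 [simp]: "I k 0"
  by (simp add: val_ge_def)

lemma I_1 [simp]: "I 0 1"
  by (simp add: val_ge_def)

lemma I_minus [simp]: "I k (- x) \<longleftrightarrow> I k x"
  by (simp add: val_ge_def)

lemma I_add: "I k x \<Longrightarrow> I k y \<Longrightarrow> I k (x + y)"
  using val_add[of x y] by (cases "x + y = 0"; cases "x = 0"; cases "y = 0") (auto simp: val_ge_def)

lemma I_diff: "I k x \<Longrightarrow> I k y \<Longrightarrow> I k (x - y)"
  using I_add[of k x "- y"] by simp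

lemma I_diff_commute: "I k (x - y) \<longleftrightarrow> I k (y - x)"
  using I_minus[of k "x - y"] by simp

lemma I_add_cancel: "I k x \<Longrightarrow> I k (x + y) \<longleftrightarrow> I k y"
  using I_add[of k x y] I_diff[of k "x + y" x] by auto

lemma I_trans: "I k (x - y) \<Longrightarrow> I k (y - z) \<Longrightarrow> I k (x - z)"
  using I_add[of k "x - y" "y - z"] by simp

lemma I_mono: "I k x \<Longrightarrow> j \<le> k \<Longrightarrow> I j x"
  by (auto simp: val_ge_def)

lemma I_mult: "I j x \<Longrightarrow> I k y \<Longrightarrow> I (j + k) (x * y)"
  using val_mult[of x y] by (cases "x = 0"; cases "y = 0") (auto simp: val_ge_def)

lemma I_mult_left: "I 0 x \<Longrightarrow> I k y \<Longrightarrow> I k (x * y)"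
  using I_mult[of 0 x k y] by simp

lemma I_mult_right: "I k x \<Longrightarrow> I 0 y \<Longrightarrow> I k (x * y)"
  using I_mult[of k x 0 y] by simp

lemma ring_of_integers_iff: "x \<in> ring_of_integers v \<longleftrightarrow> I 0 x"
  by (simp add: ring_of_integers_def)

lemma val_unit_iff: "val_unit a \<longleftrightarrow> I 0 a \<and> \<not> I 1 a"
  by (auto simp: val_unit_def val_ge_def)

lemma val_unit_nonzero: "val_unit a \<Longrightarrow> a \<noteq> 0"
  by (simp add: val_unit_def)

lemma val_unit_I: "val_unit a \<Longrightarrow> I 0 a"
  by (simp add: val_unit_iff)

lemma val_unit_1 [simp]: "val_unit 1"
  by (simp add: val_unit_def)

lemma val_unit_mult: "val_unit a \<Longrightarrow> val_unit b \<Longrightarrow> val_unit (a * b)"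
  by (auto simp: val_unit_def val_mult)

lemma val_unit_inverse: "val_unit a \<Longrightarrow> val_unit (inverse a)"
  by (auto simp: val_unit_def val_inverse)

lemma I_divide_unit: "I k x \<Longrightarrow> val_unit a \<Longrightarrow> I k (x / a)"
  using I_mult_right[of k x "inverse a"] val_unit_I[OF val_unit_inverse] by (simp add: divide_inverse)

lemma I_divide: "I k x \<Longrightarrow> a \<noteq> 0 \<Longrightarrow> I (k - v a) (x / a)"
  using I_mult[of k x "- v a" "inverse a"] by (simp add: divide_inverse val_ge_def val_inverse)

lemma I_mult_unit_iff: "val_unit a \<Longrightarrow> I k (a * x) \<longleftrightarrow> I k x"
  using I_mult_left[of a k x] I_divide_unit[of k "a * x" a] val_unit_I[of a] val_unit_nonzero[of a]
  by auto

lemma val_unit_cong: "val_unit a \<Longrightarrow> I 1 (a - b) \<Longrightarrow> val_unit b"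
  unfolding val_unit_iff
  using I_diff[of 0 a "a - b"] I_add[of 1 "a - b" b] I_mono[of 1 "a - b" 0] by auto

lemma I_square_iff: "I 1 (x * x) \<longleftrightarrow> I 1 x"
  by (cases "x = 0") (auto simp: val_ge_def val_mult)

lemma I_1_mult_iff: "I 0 x \<Longrightarrow> I 0 y \<Longrightarrow> I 1 (x * y) \<longleftrightarrow> I 1 x \<or> I 1 y"
  by (cases "x = 0"; cases "y = 0") (auto simp: val_ge_def val_mult)

lemma val_unit_2: "val_unit 2"
proof -
  obtain y where y: "I 0 (2 :: 'f)" "I 0 y" "2 * y = 1"
    using non_dyadic by (auto simp: non_dyadic_def integer_units_def ring_of_integers_iff)
  have "\<not> I 1 (2 :: 'f)"
    using I_mult_right[of 1 2 y] y by (auto simp: val_ge_def)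
  with y show ?thesis by (simp add: val_unit_iff)
qed

lemma two_nonzero [simp]: "(2 :: 'f) \<noteq> 0"
  using val_unit_2 by (simp add: val_unit_def)

lemma four_nonzero [simp]: "(4 :: 'f) \<noteq> 0"
  using mult_eq_0_iff[of 2 "2 :: 'f"] two_nonzero by simp

lemma I_half: "I k x \<Longrightarrow> I k (x / 2)"
  by (rule I_divide_unit[OF _ val_unit_2])

definition \<pi> :: 'f where "\<pi> = (SOME x. x \<noteq> 0 \<and> v x = 1)"

lemma pi_nonzero [simp]: "\<pi> \<noteq> 0" and val_pi [simp]: "v \<pi> = 1"
  using someI_ex[OF uniformizer] by (simp_all add: \<pi>_def)

lemma val_pi_power [simp]: "v (\<pi> ^ k) = int k"
  by (induction k) (simp_all add: val_mult)

lemma I_pi [simp]: "I 1 \<pi>" by (simp add: val_ge_def)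

lemma exists_scale_val_0_1:
  assumes "a \<noteq> 0"
  obtains c where "c \<noteq> 0" "v (c * c * a) = 0 \<or> v (c * c * a) = 1"
proof -
  \<comment> \<open>Multiplying by a square shifts the valuation by an even number;
    \<open>v c = - j\<close> leaves the remainder of \<open>v a\<close> modulo 2.\<close>
  define j where "j = v a div 2"
  define c where "c = (if j \<le> 0 then \<pi> ^ nat (- j) else inverse (\<pi> ^ nat j))"
  have c: "c \<noteq> 0" "v c = - j" by (auto simp: c_def val_inverse)
  have "v (c * c * a) = v a mod 2"
    using c assms by (simp add: val_mult j_def minus_div_mult_eq_mod [symmetric])
  then show thesis using that c by (metis not_mod_2_eq_0_eq_1)
qed

section \<open>Square roots of elements congruent to 1\<close>

lemma zero_if_I_all:
  assumes "\<And>k. I k x" shows "x = 0"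
  using assms[of "v x + 1"] by (simp add: val_ge_def)

text \<open>Hensel's lemma for X^2 - a by Newton iteration, with the derivative frozen at its value
  2 in the starting point 1. Convergence is only linear, but the sole denominator is the unit
  2.\<close>

lemma sqrt_near_1:
  assumes a: "I 1 (a - 1)"
  obtains s where "s * s = a" "I 1 (s - 1)"
proof -
  define s where "s = rec_nat 1 (\<lambda>_ s. s - (s * s - a) / 2)"
  have s0: "s 0 = 1" and sS: "s (Suc i) = s i - (s i * s i - a) / 2" for i
    by (simp_all add: s_def)
  have inv: "I 1 (s i - 1) \<and> I (int i + 1) (s i * s i - a)" for i
  proof (induction i)
    case 0
    then show ?case using a by (simp add: s0 I_diff_commute)
  next
    case (Suc i)
    define e where "e = s i * s i - a"
    have e: "I (int i + 1) e" "I 1 e" using Suc I_mono[of "int i + 1" e 1] by (auto simp: e_def)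
    have S: "s (Suc i) = s i - e / 2" by (simp add: sS e_def)
    have "I 1 (s (Suc i) - 1)"
      using I_diff[of 1 "s i - 1" "e / 2"] Suc I_half[OF e(2)] by (simp add: S algebra_simps)
    \<comment> \<open>Both \<open>1 - s i\<close> and \<open>e\<close> lie in the maximal ideal, so
      each summand of the new error gains one power over \<open>e\<close>.\<close>
    moreover have "s (Suc i) * s (Suc i) - a = e * (1 - s i) + e / 2 * (e / 2)"
      unfolding S by (simp add: e_def field_simps)
    moreover have "I (int i + 1 + 1) (e * (1 - s i))"
      using I_mult[OF e(1)] Suc I_diff_commute by blast
    moreover have "I (int i + 1 + 1) (e / 2 * (e / 2))"
      using I_mult[OF I_half[OF e(1)] I_half[OF e(2)]] .
    ultimately show ?case using I_add by (simp add: add.commute add.left_commute)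
  qed
  have step: "I (int i) (s j - s i)" if "i \<le> j" for i j
    using that
  proof (induction j rule: dec_induct)
    case base then show ?case by simp
  next
    case (step j)
    have "I (int i) ((s j * s j - a) / 2)"
      using inv[of j] step I_mono[of "int j + 1" _ "int i"] by (intro I_half) auto
    with step(3) have "I (int i) (s j - s i - (s j * s j - a) / 2)" by (rule I_diff)
    moreover have "s (Suc j) - s i = s j - s i - (s j * s j - a) / 2" by (simp add: sS)
    ultimately show ?case by (simp only:)
  qed
  have "\<exists>N. \<forall>i\<ge>N. \<forall>j\<ge>N. I k (s i - s j)" for k
  proof (intro exI allI impI)
    fix i j assume "nat k \<le> i" "nat k \<le> j"
    then have "I (int (nat k)) (s i - s j)"
      using I_diff[OF step[of "nat k" i] step[of "nat k" j]] by simp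
    then show "I k (s i - s j)" by (rule I_mono) simp
  qed
  then obtain L where L: "\<forall>k. \<exists>N. \<forall>i\<ge>N. I k (s i - L)"
    using complete by blast
  \<comment> \<open>A single index serves both for closeness to \<open>L\<close> and, through
    \<open>inv\<close>, for the smallness of \<open>s i * s i - a\<close>.\<close>
  have near: "\<exists>i. I k (s i - L) \<and> I 1 (s i - L) \<and> k \<le> int i" for k
  proof -
    obtain N where N: "\<forall>i\<ge>N. I (max k 1) (s i - L)" using L by blast
    then show ?thesis
      using I_mono[of "max k 1"] by (intro exI[of _ "max N (nat k)"]) auto
  qed
  have L1: "I 1 (L - 1)"
    using near[of 0] inv I_trans I_diff_commute by blast
  have "L * L - a = 0"
  proof (rule zero_if_I_all)
    fix k
    obtain i where i: "I k (s i - L)" "I 1 (s i - L)" "k \<le> int i" using near by blast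
    have "I 0 (L - 1 + 1)" "I 0 (s i - 1 + 1)"
      using L1 inv[of i] by (blast intro: I_add I_1 I_mono[of 1 _ 0] zero_le_one)+
    then have "I 0 (s i + L)" by (simp add: I_add)
    then have "I k ((s i - L) * (s i + L))" using i by (intro I_mult_right)
    moreover have "I k (s i * s i - a)" using inv[of i] i I_mono[of "int i + 1" _ k] by auto
    ultimately have "I k (s i * s i - a - (s i - L) * (s i + L))" by (rule I_diff[rotated])
    then show "I k (L * L - a)" by (simp add: algebra_simps)
  qed
  then show thesis using that L1 by simp
qed

section \<open>Counting in the residue field\<close>

text \<open>Congruent elements give \<open>SOME\<close> the same predicate, hence the same choice.
  Congruence thus becomes equality, and residue classes can be counted as elements of the
  field.\<close>

definition residue_rep :: "'f \<Rightarrow> 'f" where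
  "residue_rep x = (SOME y. I 1 (x - y))"

lemma residue_rep: "I 1 (x - residue_rep x)"
  unfolding residue_rep_def by (rule someI[of _ x]) simp

lemma residue_rep_eq_iff: "residue_rep x = residue_rep y \<longleftrightarrow> I 1 (x - y)"
proof
  assume "residue_rep x = residue_rep y"
  then show "I 1 (x - y)" using residue_rep I_trans I_diff_commute by metis
next
  assume "I 1 (x - y)"
  then have "(\<lambda>z. I 1 (x - z)) = (\<lambda>z. I 1 (y - z))"
    using I_trans I_diff_commute by blast
  then show "residue_rep x = residue_rep y" by (simp add: residue_rep_def)
qed

lemma residue_rep_integral: "I 0 x \<Longrightarrow> I 0 (residue_rep x)"
  using I_diff[of 0 x "x - residue_rep x"] I_mono[OF residue_rep, of 0 x] by simp

abbreviation reps :: "'f set" where "reps \<equiv> residue_rep ` {x. I 0 x}"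

lemma finite_reps: "finite reps"
proof -
  let ?r = "{(x, y). x \<in> ring_of_integers v \<and> y \<in> ring_of_integers v \<and> x - y \<in> maximal_ideal v}"
  have eq: "residue_rep x = residue_rep y" if "?r `` {x} = ?r `` {y}" "I 0 x" "I 0 y" for x y
  proof -
    have "y \<in> ?r `` {y}" using that by (simp add: ring_of_integers_iff maximal_ideal_def)
    then have "y \<in> ?r `` {x}" using that by simp
    then show ?thesis by (simp add: maximal_ideal_def residue_rep_eq_iff)
  qed
  have "finite ((\<lambda>x. ?r `` {x}) ` {x. I 0 x})"
    using finite_residue_field
    by (rule rev_finite_subset) (auto simp: residue_field_def quotient_def ring_of_integers_iff)
  \<comment> \<open>A representative is recovered from its class through any chosen member, so there
    are no more representatives than classes.\<close>
  moreover have "reps \<subseteq> (\<lambda>C. residue_rep (SOME x. I 0 x \<and> ?r `` {x} = C)) ` (\<lambda>x. ?r `` {x}) ` {x. I 0 x}"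
  proof
    fix y assume "y \<in> reps"
    then obtain x where x: "I 0 x" "y = residue_rep x" by blast
    define z where "z = (SOME z. I 0 z \<and> ?r `` {z} = ?r `` {x})"
    have "I 0 z \<and> ?r `` {z} = ?r `` {x}"
      unfolding z_def by (rule someI[of _ x]) (use x in simp)
    then have "y = residue_rep z" using eq[of x z] x by simp
    then show "y \<in> (\<lambda>C. residue_rep (SOME x. I 0 x \<and> ?r `` {x} = C)) ` (\<lambda>x. ?r `` {x}) ` {x. I 0 x}"
      unfolding z_def using x(1) by blast
  qed
  ultimately show ?thesis using finite_subset by blast
qed

lemma I_square_diff_iff:
  assumes "I 0 x" "I 0 y"
  shows "I 1 (x * x - y * y) \<longleftrightarrow> I 1 (x - y) \<or> I 1 (x + y)"
  using I_1_mult_iff[of "x - y" "x + y"] assms I_add I_diff by (simp add: algebra_simps)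

lemma residue_rep_square:
  "I 0 x \<Longrightarrow> residue_rep (residue_rep x * residue_rep x) = residue_rep (x * x)"
  using residue_rep[of x] residue_rep_integral[of x] I_diff_commute[of 1 "residue_rep x" x]
  by (simp add: residue_rep_eq_iff I_square_diff_iff)

text \<open>Squaring identifies 1 and -1, which differ modulo the maximal ideal because 2 is a unit.
  A non-injective self-map of a finite set misses a class.\<close>

lemma residue_nonsquare:
  obtains \<Delta> where "val_unit \<Delta>" "\<And>x. I 0 x \<Longrightarrow> \<not> I 1 (x * x - \<Delta>)"
proof -
  let ?f = "\<lambda>x. residue_rep (x * x)"
  have maps: "?f ` reps \<subseteq> reps"
    using I_mult[of 0 _ 0] by (auto simp: residue_rep_integral)
  have "\<not> inj_on ?f reps"
  proof
    assume "inj_on ?f reps"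
    moreover have "?f (residue_rep 1) = ?f (residue_rep (- 1))"
      by (simp add: residue_rep_square)
    ultimately have "residue_rep 1 = residue_rep (-1)"
      by (auto dest: inj_onD)
    then have "I 1 (2 :: 'f)" using residue_rep_eq_iff by fastforce
    then show False using val_unit_2 by (simp add: val_unit_iff)
  qed
  then have "?f ` reps \<noteq> reps"
    using finite_surj_inj[OF finite_reps] by auto
  then obtain d where d: "I 0 d" "residue_rep d \<notin> ?f ` reps" using maps by blast
  have ns: "\<not> I 1 (x * x - d)" if "I 0 x" for x
  proof
    assume "I 1 (x * x - d)"
    then have "residue_rep d = ?f (residue_rep x)"
      using residue_rep_square[OF that] residue_rep_eq_iff by metis
    then show False using d that by blast
  qed
  \<comment> \<open>0 is a square, so \<open>d\<close> cannot lie in the maximal ideal.\<close>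
  have "val_unit d" using d(1) ns[of 0] by (auto simp: val_unit_iff)
  then show thesis using that ns by blast
qed

text \<open>Pigeonhole: both sides of \<open>a x\<^sup>2 = c - b y\<^sup>2\<close> take more than half of the residue classes.\<close>

lemma binary_form_residue_surj:
  assumes a: "val_unit a" and b: "val_unit b" and c: "I 0 c"
  obtains x y where "I 0 x" "I 0 y" "I 1 (a * (x * x) + b * (y * y) - c)"
proof -
  let ?f = "\<lambda>x. residue_rep (x * x)"
  let ?S = "?f ` {x. I 0 x}"
  have "?S \<subseteq> reps" using I_mult[of 0 _ 0] by auto
  then have finS: "finite ?S" using finite_reps finite_subset by blast
  \<comment> \<open>\<open>t\<close> picks a root of every square. Each class is plus or minus a
    chosen root and the zero class is both, so there are fewer classes than twice the number of
    squares.\<close>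
  obtain t where t: "\<forall>s\<in>?S. I 0 (t s) \<and> ?f (t s) = s"
    using bchoice[of ?S "\<lambda>s x. I 0 x \<and> ?f x = s"] by auto
  define A where "A = (\<lambda>s. residue_rep (t s)) ` ?S"
  define B where "B = (\<lambda>s. residue_rep (- t s)) ` ?S"
  have fin: "finite A" "finite B" and le: "card A \<le> card ?S" "card B \<le> card ?S"
    using finS by (simp_all only: A_def B_def finite_imageI card_image_le)
  have "reps \<subseteq> A \<union> B"
  proof
    fix y assume "y \<in> reps"
    then obtain x where x: "I 0 x" "y = residue_rep x" by blast
    have "I 1 (x * x - t (?f x) * t (?f x))" "I 0 (t (?f x))"
      using t x residue_rep_eq_iff by (metis (no_types, lifting) imageI mem_Collect_eq)+
    then have "I 1 (x - t (?f x)) \<or> I 1 (x - - t (?f x))"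
      using I_square_diff_iff x by simp
    then have "y = residue_rep (t (?f x)) \<or> y = residue_rep (- t (?f x))"
      using x residue_rep_eq_iff by blast
    then show "y \<in> A \<union> B" using x unfolding A_def B_def by blast
  qed
  then have "card reps \<le> card (A \<union> B)"
    using fin by (intro card_mono) auto
  moreover have "residue_rep 0 \<in> A \<inter> B"
  proof -
    have 0: "?f 0 \<in> ?S" by (rule imageI) simp
    then have "?f (t (?f 0)) = ?f 0" using t by blast
    then have "I 1 (t (?f 0))" using residue_rep_eq_iff I_square_iff by fastforce
    then have "residue_rep 0 = residue_rep (t (?f 0))" "residue_rep 0 = residue_rep (- t (?f 0))"
      by (simp_all add: residue_rep_eq_iff)
    then show ?thesis unfolding A_def B_def by (intro IntI image_eqI[OF _ 0])
  qed
  then have "A \<inter> B \<noteq> {}" by blast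
  then have "1 \<le> card (A \<inter> B)" using fin by (simp add: Suc_le_eq card_gt_0_iff)
  moreover have "card A + card B = card (A \<union> B) + card (A \<inter> B)"
    using fin by (rule card_Un_Int)
  ultimately have large: "card reps < 2 * card ?S" using le by linarith
  let ?C = "(\<lambda>x. residue_rep (a * (x * x))) ` {x. I 0 x}"
    and ?D = "(\<lambda>y. residue_rep (c - b * (y * y))) ` {x. I 0 x}"
  have sub: "?C \<subseteq> reps" "?D \<subseteq> reps"
    using a b c I_mult[of 0 _ 0] I_diff[of 0] by (auto simp: val_unit_I)
  \<comment> \<open>Scaling by a unit and translating keep distinct squares distinct. Each side thus
    takes at least as many classes as there are squares, and the two sets must meet.\<close>
  have "card ?S \<le> card ?C"
  proof (rule card_le_if_inj_on_rel[where r = "\<lambda>s d. \<exists>x. I 0 x \<and> s = ?f x \<and> d = residue_rep (a * (x * x))"])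
    show "finite ?C" using sub finite_reps finite_subset by blast
    fix s1 s2 d
    assume "\<exists>x. I 0 x \<and> s1 = ?f x \<and> d = residue_rep (a * (x * x))"
      "\<exists>x. I 0 x \<and> s2 = ?f x \<and> d = residue_rep (a * (x * x))"
    then obtain x y where "s1 = ?f x" "s2 = ?f y" "I 1 (a * (x * x) - a * (y * y))"
      using residue_rep_eq_iff by metis
    then show "s1 = s2"
      using I_mult_unit_iff[OF a] by (simp add: residue_rep_eq_iff right_diff_distrib [symmetric])
  qed auto
  moreover have "card ?S \<le> card ?D"
  proof (rule card_le_if_inj_on_rel[where r = "\<lambda>s d. \<exists>x. I 0 x \<and> s = ?f x \<and> d = residue_rep (c - b * (x * x))"])
    show "finite ?D" using sub finite_reps finite_subset by blast
    fix s1 s2 d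
    assume "\<exists>x. I 0 x \<and> s1 = ?f x \<and> d = residue_rep (c - b * (x * x))"
      "\<exists>x. I 0 x \<and> s2 = ?f x \<and> d = residue_rep (c - b * (x * x))"
    then obtain x y where "s1 = ?f x" "s2 = ?f y" "I 1 ((c - b * (y * y)) - (c - b * (x * x)))"
      using residue_rep_eq_iff by metis
    then have "s1 = ?f x" "s2 = ?f y" "I 1 (b * (x * x - y * y))"
      by (simp_all add: algebra_simps)
    then show "s1 = s2"
      using I_mult_unit_iff[OF b] by (simp add: residue_rep_eq_iff)
  qed auto
  moreover have "card (?C \<union> ?D) \<le> card reps"
    using sub finite_reps by (intro card_mono) auto
  ultimately have "?C \<inter> ?D \<noteq> {}"
    using large card_Un_disjoint[of ?C ?D] finite_subset[OF sub(1) finite_reps]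
      finite_subset[OF sub(2) finite_reps] by linarith
  then obtain x y where "I 0 x" "I 0 y" "residue_rep (a * (x * x)) = residue_rep (c - b * (y * y))"
    by blast
  then show thesis
    using that[of x y] by (simp add: residue_rep_eq_iff algebra_simps)
qed

section \<open>Uniformizers and anisotropic binary forms\<close>

text \<open>Uniformizers, expressed through \<open>I\<close> so that congruence modulo the square of
  the maximal ideal visibly preserves them.\<close>

definition val_prime :: "'f \<Rightarrow> bool" where "val_prime a \<longleftrightarrow> I 1 a \<and> \<not> I 2 a"

lemma val_prime_iff: "val_prime a \<longleftrightarrow> a \<noteq> 0 \<and> v a = 1"
  by (auto simp: val_prime_def val_ge_def)

lemma val_prime_cong: "val_prime a \<Longrightarrow> I 2 (a - b) \<Longrightarrow> val_prime b"
  unfolding val_prime_def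
  using I_diff[of 1 a "a - b"] I_add[of 2 "a - b" b] I_mono[of 2 "a - b" 1] by auto

lemma val_prime_over_pi: "val_prime a \<Longrightarrow> val_unit (a / \<pi>)"
  by (auto simp: val_prime_iff val_unit_def divide_inverse val_mult val_inverse)

lemma I_2_pi_iff: "I 2 (\<pi> * a) \<longleftrightarrow> I 1 a"
  by (cases "a = 0") (auto simp: val_ge_def val_mult)

text \<open>When -ab is not a square in the residue field, a x^2 + b y^2 is anisotropic there: a
  zero with unit \<open>x\<close>, multiplied by b / x^2, exhibits -ab as the square of b y /
  x.\<close>

lemma residue_anisotropic:
  assumes "val_unit a" "val_unit b" and ns: "\<And>t. I 0 t \<Longrightarrow> \<not> I 1 (t * t + a * b)"
    and "I 0 x" "I 0 y" and h: "I 1 (a * (x * x) + b * (y * y))"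
  shows "I 1 x \<and> I 1 y"
proof -
  have x: "I 1 x"
  proof (rule ccontr)
    assume "\<not> I 1 x"
    then have x: "val_unit x" using assms by (simp add: val_unit_iff)
    then have "x \<noteq> 0" by (simp add: val_unit_def)
    have "I 1 ((a * (x * x) + b * (y * y)) * b / (x * x))"
      using I_divide_unit[OF I_mult_right[OF h val_unit_I] val_unit_mult] assms x by blast
    moreover have "(a * (x * x) + b * (y * y)) * b / (x * x) = (b * y / x) * (b * y / x) + a * b"
      using \<open>x \<noteq> 0\<close> by (simp add: field_simps)
    moreover have "I 0 (b * y / x)"
      using I_divide_unit[OF I_mult_left[OF val_unit_I] x] assms by blast
    ultimately show False using ns by metis
  qed
  then have "I 1 (a * (x * x))"
    using I_mult_left[OF val_unit_I[OF assms(1)], of 1 "x * x"] by (simp add: I_square_iff)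
  with h have "I 1 (b * (y * y))" by (simp add: I_add_cancel)
  then show ?thesis using x assms by (simp add: I_mult_unit_iff I_square_iff)
qed

lemma bounded_I: "finite A \<Longrightarrow> \<exists>j. \<forall>a\<in>A. I j (f a)"
proof (induction A rule: finite_induct)
  case (insert a A)
  then obtain j where "\<forall>a\<in>A. I j (f a)" by blast
  moreover have "I (v (f a)) (f a)" by (simp add: val_ge_def)
  ultimately show ?case
    using I_mono[of j _ "min j (v (f a))"] I_mono[of "v (f a)" _ "min j (v (f a))"]
    by (intro exI[of _ "min j (v (f a))"]) auto
qed simp

end

section \<open>Integral submodules and maximal lattices\<close>

text \<open>Finite generation is left out, so that unions of chains, linear images and intersections
  with subspaces stay in the class.\<close>

definition (in nondyadic_local_field) osubmodule ::
  "('f \<Rightarrow> 'w::ab_group_add \<Rightarrow> 'w) \<Rightarrow> 'w set \<Rightarrow> bool" where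
  "osubmodule s K \<longleftrightarrow> 0 \<in> K \<and> (\<forall>x\<in>K. \<forall>y\<in>K. x + y \<in> K) \<and> (\<forall>c x. I 0 c \<longrightarrow> x \<in> K \<longrightarrow> s c x \<in> K)"

context nondyadic_local_field
begin

lemma osubmodule_sum:
  "osubmodule s K \<Longrightarrow> (\<And>x. x \<in> T \<Longrightarrow> f x \<in> K) \<Longrightarrow> sum f T \<in> K"
  by (induction T rule: infinite_finite_induct) (auto simp: osubmodule_def)

lemma integer_span_minimal:
  assumes "osubmodule s K" "S \<subseteq> K" shows "integer_span v s S \<subseteq> K"
proof
  fix x assume "x \<in> integer_span v s S"
  then obtain T c where T: "T \<subseteq> S" "\<forall>a\<in>T. I 0 (c a)" "x = (\<Sum>a\<in>T. s (c a) a)"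
    unfolding integer_span_def ring_of_integers_iff by blast
  have "s (c a) a \<in> K" if "a \<in> T" for a
    using that T assms by (auto simp: osubmodule_def)
  then show "x \<in> K" unfolding T(3) by (rule osubmodule_sum[OF assms(1)])
qed

lemma integer_span_induct:
  assumes "x \<in> integer_span v s S" "osubmodule s {x. P x}" "\<And>x. x \<in> S \<Longrightarrow> P x"
  shows "P x"
  using integer_span_minimal[OF assms(2), of S] assms by blast

lemma osubmodule_integer_span:
  assumes "vector_space s" shows "osubmodule s (integer_span v s S)"
proof -
  interpret vector_space s by fact
  show ?thesis
    unfolding osubmodule_def
  proof (intro conjI ballI allI impI)
    show "0 \<in> integer_span v s S"
      unfolding integer_span_def by (force intro: exI[of _ "{}"])
  next
    fix x y assume "x \<in> integer_span v s S" "y \<in> integer_span v s S"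
    then obtain T c U d where T: "finite T" "T \<subseteq> S" "\<forall>x\<in>T. I 0 (c x)" "x = (\<Sum>a\<in>T. s (c a) a)"
      and U: "finite U" "U \<subseteq> S" "\<forall>x\<in>U. I 0 (d x)" "y = (\<Sum>a\<in>U. s (d a) a)"
      unfolding integer_span_def ring_of_integers_iff by blast
    \<comment> \<open>The two sums have different supports; coefficients are extended by 0 to the
      union.\<close>
    define c' d' where "c' a = (if a \<in> T then c a else 0)" and "d' a = (if a \<in> U then d a else 0)" for a
    have "x = (\<Sum>a\<in>T \<union> U. s (c' a) a)" "y = (\<Sum>a\<in>T \<union> U. s (d' a) a)"
      unfolding T U c'_def d'_def using T(1) U(1) by (auto intro!: sum.mono_neutral_cong_left)
    then have "x + y = (\<Sum>a\<in>T \<union> U. s (c' a + d' a) a)"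
      by (simp add: scale_left_distrib sum.distrib)
    moreover have "\<forall>a\<in>T \<union> U. I 0 (c' a + d' a)"
      using T U by (auto simp: c'_def d'_def I_add)
    ultimately show "x + y \<in> integer_span v s S"
      unfolding integer_span_def ring_of_integers_iff using T U
      by (auto intro!: exI[of _ "T \<union> U"] exI[of _ "\<lambda>a. c' a + d' a"])
  next
    fix e x assume e: "I 0 e" and "x \<in> integer_span v s S"
    then obtain T c where T: "finite T" "T \<subseteq> S" "\<forall>x\<in>T. I 0 (c x)" "x = (\<Sum>a\<in>T. s (c a) a)"
      unfolding integer_span_def ring_of_integers_iff by blast
    have "s e x = (\<Sum>a\<in>T. s (e * c a) a)" by (simp add: T scale_sum_right)
    then show "s e x \<in> integer_span v s S"
      unfolding integer_span_def ring_of_integers_iff using T e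
      by (auto intro!: exI[of _ "T"] exI[of _ "\<lambda>a. e * c a"] I_mult_left)
  qed
qed

lemma integer_span_superset:
  assumes "vector_space s" shows "S \<subseteq> integer_span v s S"
proof
  interpret vector_space s by fact
  fix x assume "x \<in> S"
  then show "x \<in> integer_span v s S"
    unfolding integer_span_def ring_of_integers_iff
    by (auto intro!: exI[of _ "{x}"] exI[of _ "\<lambda>_. 1"])
qed

lemma span_integer_span:
  assumes "vector_space s" shows "module.span s (integer_span v s S) = module.span s S"
proof -
  interpret vector_space s by fact
  have "osubmodule s (span S)"
    by (auto simp: osubmodule_def span_zero span_add span_scale)
  then have "integer_span v s S \<subseteq> span S"
    using span_superset by (rule integer_span_minimal)
  then show ?thesis
    using integer_span_superset[OF assms, of S] span_mono span_minimal subspace_span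
    by (meson subset_antisym)
qed

text \<open>The ring of integers is itself a submodule of the field, so it contains the module
  generated by the norms once it contains the norms.\<close>

lemma norm_ideal_integral_iff:
  "norm_ideal v B K \<subseteq> ring_of_integers v \<longleftrightarrow> (\<forall>x\<in>K. I 0 (B x x))"
proof
  interpret F: vector_space "(*) :: 'f \<Rightarrow> 'f \<Rightarrow> 'f" by unfold_locales (auto simp: algebra_simps)
  show "\<forall>x\<in>K. I 0 (B x x)" if "norm_ideal v B K \<subseteq> ring_of_integers v"
    using that integer_span_superset[OF F.vector_space_axioms, of "{B x x |x. x \<in> K}"]
    unfolding norm_ideal_def ring_of_integers_def by blast
  show "norm_ideal v B K \<subseteq> ring_of_integers v" if "\<forall>x\<in>K. I 0 (B x x)"
    unfolding norm_ideal_def using that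
    by (intro integer_span_minimal) (auto simp: osubmodule_def ring_of_integers_iff I_add I_mult_left)
qed

end

text \<open>Bilinearity on the whole ambient type spares membership conditions. The final theorem
  reaches this setting by composing the given form with a projection onto \<open>FM\<close>.\<close>

locale quadratic_ambient = nondyadic_local_field v + vector_space scale
  for v :: "'f::field \<Rightarrow> int" and scale :: "'f \<Rightarrow> 'v::ab_group_add \<Rightarrow> 'v" (infixr \<open>*s\<close> 75) +
  fixes B :: "'v \<Rightarrow> 'v \<Rightarrow> 'f"
  assumes B_commute: "B x y = B y x"
    and B_add_left: "B (x + y) z = B x z + B y z"
    and B_scale_left: "B (c *s x) y = c * B x y"
begin

abbreviation Q :: "'v \<Rightarrow> 'f" where "Q x \<equiv> B x x"

lemma B_add_right: "B z (x + y) = B z x + B z y"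
  using B_add_left B_commute by metis

lemma B_scale_right: "B y (c *s x) = c * B y x"
  using B_scale_left B_commute by metis

lemma B_zero_left [simp]: "B 0 x = 0"
  using B_scale_left[of 0 0 x] by simp

lemma B_zero_right [simp]: "B x 0 = 0"
  using B_commute[of x 0] by simp

lemma B_minus_left: "B (- x) y = - B x y"
  using B_scale_left[of "-1" x y] by simp

lemma B_minus_right: "B x (- y) = - B x y"
  using B_scale_right[of x "-1" y] by simp

lemma B_diff_left: "B (x - y) z = B x z - B y z"
  using B_add_left[of x "- y" z] by (simp add: B_minus_left)

lemma B_diff_right: "B z (x - y) = B z x - B z y"
  using B_add_right[of z x "- y"] by (simp add: B_minus_right)

lemmas B_simps = B_add_left B_add_right B_scale_left B_scale_right B_minus_left B_minus_right
  B_diff_left B_diff_right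

lemma B_sum_left: "B (sum f A) y = (\<Sum>a\<in>A. B (f a) y)"
  by (induction A rule: infinite_finite_induct) (auto simp: B_simps)

lemma polarization: "2 * B x y = Q (x + y) - Q x - Q y"
  by (simp add: B_simps B_commute[of y x])

definition osub :: "'v set \<Rightarrow> bool" where "osub = osubmodule scale"

lemma osub_zero: "osub K \<Longrightarrow> 0 \<in> K"
  and osub_add: "osub K \<Longrightarrow> x \<in> K \<Longrightarrow> y \<in> K \<Longrightarrow> x + y \<in> K"
  and osub_scale: "osub K \<Longrightarrow> I 0 c \<Longrightarrow> x \<in> K \<Longrightarrow> c *s x \<in> K"
  by (auto simp: osub_def osubmodule_def)

lemma osub_minus: "osub K \<Longrightarrow> x \<in> K \<Longrightarrow> - x \<in> K"
  using osub_scale[of K "-1" x] by simp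

lemma osub_diff: "osub K \<Longrightarrow> x \<in> K \<Longrightarrow> y \<in> K \<Longrightarrow> x - y \<in> K"
  using osub_add[of K x "- y"] osub_minus[of K y] by simp

definition integral_sub :: "'v set \<Rightarrow> bool" where
  "integral_sub K \<longleftrightarrow> osub K \<and> (\<forall>x\<in>K. I 0 (Q x))"

text \<open>Polarization divides by the unit 2, so a bound on the norms of a submodule bounds all
  its inner products.\<close>

lemma B_I:
  assumes "osub K" "\<And>x. x \<in> K \<Longrightarrow> I k (Q x)" "x \<in> K" "y \<in> K"
  shows "I k (B x y)"
proof -
  have "I k (Q (x + y) - Q x - Q y)"
    using assms osub_add by (intro I_diff) auto
  then have "I k (2 * B x y)" by (simp only: polarization)
  then show ?thesis by (simp add: I_mult_unit_iff val_unit_2)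
qed

lemma integral_sub_B: "integral_sub K \<Longrightarrow> x \<in> K \<Longrightarrow> y \<in> K \<Longrightarrow> I 0 (B x y)"
  using B_I[of K 0 x y] by (simp add: integral_sub_def)

lemma linearI:
  assumes "\<And>x y. f (x + y) = f x + f y" "\<And>c x. f (c *s x) = c *s f x"
  shows "Vector_Spaces.linear (*s) (*s) f"
  using assms vector_space_axioms by (simp add: Vector_Spaces.linear_iff)

lemma linear_addD: "Vector_Spaces.linear (*s) (*s) f \<Longrightarrow> f (x + y) = f x + f y"
  and linear_scaleD: "Vector_Spaces.linear (*s) (*s) f \<Longrightarrow> f (c *s x) = c *s f x"
  by (simp_all add: Vector_Spaces.linear_iff)

section \<open>Hyperbolic planes and representation by maximal lattices\<close>

text \<open>The Gram determinant of \<open>x, z\<close> is minus an element congruent to 1, hence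
  minus a square by \<open>sqrt_near_1\<close>, and the plane is hyperbolic over the integers. The
  last two conclusions record what is later used of \<open>e, f\<close> generating the same module
  as \<open>x, z\<close>.\<close>

lemma hyperbolic_pair:
  assumes xz: "B x z = 1" and x: "I 0 (Q x)" and z: "I 1 (Q z)"
  obtains e f where "Q e = 0" "Q f = 0" "B e f = 1"
    "\<And>K. osub K \<Longrightarrow> x \<in> K \<Longrightarrow> z \<in> K \<Longrightarrow> e \<in> K \<and> f \<in> K"
    "\<And>w. B w e = 0 \<and> B w f = 0 \<longleftrightarrow> B w x = 0 \<and> B w z = 0"
proof -
  define a c where "a = Q x" and "c = Q z"
  have a: "I 0 a" and c: "I 1 c" using x z by (simp_all add: a_def c_def)
  obtain s where s: "s * s = 1 - a * c" "I 1 (s - 1)"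
    using sqrt_near_1[of "1 - a * c"] I_mult_left[OF a c] by auto
  have u1: "val_unit (1 + s)"
    using val_unit_cong[OF val_unit_2, of "1 + s"] s(2) I_diff_commute[of 1 s 1] by simp
  \<comment> \<open>A root of c t^2 + 2 t + a with the square root moved to the denominator: the
    formula survives \<open>c = 0\<close> and is visibly integral.\<close>
  define t where "t = - a / (1 + s)"
  have t: "I 0 t" unfolding t_def using a u1 by (intro I_divide_unit) auto
  have ts: "t * (1 + s) = - a" using val_unit_nonzero[OF u1] by (simp add: t_def)
  have root: "a + 2 * t + t * t * c = 0"
  proof -
    have "(a + 2 * t + t * t * c) * ((1 + s) * (1 + s)) =
        a * ((1 + s) * (1 + s)) + 2 * (t * (1 + s)) * (1 + s) + (t * (1 + s)) * (t * (1 + s)) * c"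
      by (simp add: algebra_simps)
    also have "\<dots> = a * (s * s - (1 - a * c))"
      unfolding ts by (simp add: algebra_simps)
    finally show ?thesis using val_unit_nonzero[OF u1] s by simp
  qed
  define u where "u = 1 + t * c"
  have u: "val_unit u"
    using val_unit_cong[OF val_unit_1, of u] I_mult_left[OF t c] by (simp add: u_def)
  have u0: "u \<noteq> 0" using u by (simp add: val_unit_def)
  \<comment> \<open>\<open>e\<close> is isotropic because \<open>t\<close> is a root. Subtracting a
    multiple of \<open>e\<close> from \<open>z\<close> cancels \<open>Q z\<close>, and dividing by
    \<open>u = B e z\<close> normalises the pairing.\<close>
  define e f where "e = x + t *s z" and "f = (1 / u) *s (z - (c / (2 * u)) *s e)"
  have Qe: "Q e = 0"
    using root xz by (simp add: e_def B_simps B_commute[of z x] algebra_simps flip: a_def c_def)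
  have ez: "B e z = u" "B z e = u"
    using xz by (simp_all add: e_def u_def c_def B_simps B_commute[of z x])
  show thesis
  proof (rule that[of e f])
    show "Q e = 0" by fact
    show "B e f = 1" using u0 by (simp add: f_def B_simps ez Qe)
    show "Q f = 0" using u0 by (simp add: f_def B_simps ez Qe field_simps flip: c_def)
    fix K assume K: "osub K" "x \<in> K" "z \<in> K"
    have "e \<in> K" using K t by (simp add: e_def osub_add osub_scale)
    moreover have "I 0 (1 / u)" "I 0 (c / (2 * u))"
      using u val_unit_2 I_mono[OF c, of 0]
      by (auto intro!: I_divide_unit val_unit_mult)
    ultimately show "e \<in> K \<and> f \<in> K" using K by (simp add: f_def osub_diff osub_scale)
  next
    fix w
    show "B w e = 0 \<and> B w f = 0 \<longleftrightarrow> B w x = 0 \<and> B w z = 0"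
      using u0 by (auto simp: f_def e_def B_simps)
  qed
qed

text \<open>Induction on \<open>k\<close>, which bounds independent sets in \<open>W\<close>.
  Maximality is phrased vector by vector, a form that passes to the part of \<open>M\<close>
  orthogonal to a hyperbolic plane; the bound \<open>j\<close> guarantees a pairing of least
  valuation.\<close>

lemma maximal_represents:
  assumes "subspace W"
    and "\<And>T. independent T \<Longrightarrow> T \<subseteq> W \<Longrightarrow> finite T \<and> card T \<le> k"
    and "integral_sub M" "M \<subseteq> W" "integral_sub N" "N \<subseteq> W"
    and "\<And>x. x \<in> W \<Longrightarrow> I 0 (Q x) \<Longrightarrow> (\<And>m. m \<in> M \<Longrightarrow> I 0 (B x m)) \<Longrightarrow> x \<in> M"
    and "\<And>x y. x \<in> N \<Longrightarrow> y \<in> M \<Longrightarrow> I j (B x y)"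
  shows "\<exists>g. Vector_Spaces.linear (*s) (*s) g \<and> g ` W \<subseteq> W \<and> (\<forall>x\<in>W. Q (g x) = Q x) \<and> g ` N \<subseteq> M"
  using assms
proof (induction k arbitrary: W M N)
  case (0 W M N)
  have "W = {0}"
  proof -
    have "x = 0" if "x \<in> W" for x
    proof (rule ccontr)
      assume "x \<noteq> 0"
      then have "independent {x}" by simp
      then show False using 0(2)[of "{x}"] that by simp
    qed
    then show ?thesis using subspace_0[OF 0(1)] by blast
  qed
  then have "N \<subseteq> M" using 0 osub_zero[of M] by (auto simp: integral_sub_def)
  then show ?case by (intro exI[of _ "\<lambda>x. x"]) (auto intro: linearI)
next
  case (Suc k W M N)
  note W = Suc.prems(1) and bound = Suc.prems(2) and M = Suc.prems(3) and MW = Suc.prems(4)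
    and N = Suc.prems(5) and NW = Suc.prems(6) and max = Suc.prems(7) and bdd = Suc.prems(8)
  have oM: "osub M" and oN: "osub N" using M N by (auto simp: integral_sub_def)
  have QM: "I 0 (Q x)" if "x \<in> M" for x using M that by (simp add: integral_sub_def)
  have QN: "I 0 (Q x)" if "x \<in> N" for x using N that by (simp add: integral_sub_def)
  show ?case
  proof (cases "\<forall>x\<in>N. \<forall>y\<in>M. I 0 (B x y)")
    case True
    then have "N \<subseteq> M" using max NW QN by blast
    then show ?thesis by (intro exI[of _ "\<lambda>x. x"]) (auto intro: linearI)
  next
    case False
    then obtain x0 y0 where xy0: "x0 \<in> N" "y0 \<in> M" "\<not> I 0 (B x0 y0)" by blast
    \<comment> \<open>\<open>j\<close> bounds the valuations from below, so \<open>nat\<close>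
      truncates nothing and \<open>LEAST\<close> finds a minimal pair.\<close>
    define P where "P = (\<lambda>d. \<exists>x\<in>N. \<exists>y\<in>M. B x y \<noteq> 0 \<and> nat (v (B x y) - j) = d)"
    have "P (nat (v (B x0 y0) - j))"
      using xy0 by (auto simp: P_def val_ge_def)
    then have PL: "P (LEAST d. P d)" by (rule LeastI)
    then obtain x y where xy: "x \<in> N" "y \<in> M" "B x y \<noteq> 0" "nat (v (B x y) - j) = (LEAST d. P d)"
      unfolding P_def by blast
    have least: "I (v (B x y)) (B x' y')" if "x' \<in> N" "y' \<in> M" for x' y'
    proof (cases "B x' y' = 0")
      case False
      then have "P (nat (v (B x' y') - j))" using that unfolding P_def by blast
      then have "nat (v (B x y) - j) \<le> nat (v (B x' y') - j)" unfolding xy(4) by (rule Least_le)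
      then show ?thesis using bdd[OF that] False by (simp add: val_ge_def)
    qed simp
    have neg: "v (B x y) < 0" using least[OF xy0(1,2)] xy0(3) by (auto simp: val_ge_def)
    \<comment> \<open>By minimality, \<open>\<beta>\<close> times any pairing of \<open>N\<close>
      with \<open>M\<close> is integral, while \<open>\<beta>\<close> itself lies in the maximal
      ideal.\<close>
    define \<beta> where "\<beta> = inverse (B x y)"
    have \<beta>: "I 1 \<beta>" "I 0 \<beta>" "\<beta> * B x y = 1" "I (- v (B x y)) \<beta>"
      using neg xy(3) by (auto simp: \<beta>_def val_ge_def val_inverse)
    have small: "I 0 (\<beta> * B x' y')" if "x' \<in> N" "y' \<in> M" for x' y'
      using I_mult[OF \<beta>(4) least[OF that]] by simp
    define z z' where "z = \<beta> *s y" and "z' = \<beta> *s x"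
    have zM: "z \<in> M" and z'N: "z' \<in> N" using xy \<beta> oM oN by (auto simp: z_def z'_def osub_scale)
    \<comment> \<open>After scaling, \<open>x\<close> pairs integrally with \<open>M\<close>, so
      maximality pulls it into \<open>M\<close>. The pair \<open>y, z'\<close> then lies in
      \<open>M\<close>, and \<open>x, z\<close> will give the coordinates on
      \<open>N\<close>.\<close>
    have z'M: "z' \<in> M"
    proof (rule max)
      show "z' \<in> W" using z'N NW by blast
      show "I 0 (Q z')" using z'N QN by blast
      show "I 0 (B z' m)" if "m \<in> M" for m using small[OF xy(1) that] by (simp add: z'_def B_simps)
    qed
    have Qz: "I 1 (Q z)" "I 1 (Q z')"
      using I_mult_right[OF \<beta>(1) integral_sub_B[OF M xy(2) zM]]
        I_mult_right[OF \<beta>(1) integral_sub_B[OF N xy(1) z'N]]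
      by (simp_all add: z_def z'_def B_simps)
    have Bxz: "B x z = 1" "B y z' = 1" using \<beta> by (simp_all add: z_def z'_def B_simps B_commute[of y x])
    obtain e f where e: "Q e = 0" "Q f = 0" "B e f = 1"
      and eK: "\<And>K. osub K \<Longrightarrow> x \<in> K \<Longrightarrow> z \<in> K \<Longrightarrow> e \<in> K \<and> f \<in> K"
      and ew: "\<And>w. B w e = 0 \<and> B w f = 0 \<longleftrightarrow> B w x = 0 \<and> B w z = 0"
      using hyperbolic_pair[OF Bxz(1) QN[OF xy(1)] Qz(1)] by metis
    obtain e' f' where e': "Q e' = 0" "Q f' = 0" "B e' f' = 1"
      and eK': "\<And>K. osub K \<Longrightarrow> y \<in> K \<Longrightarrow> z' \<in> K \<Longrightarrow> e' \<in> K \<and> f' \<in> K"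
      and ew': "\<And>w. B w e' = 0 \<and> B w f' = 0 \<longleftrightarrow> B w y = 0 \<and> B w z' = 0"
      using hyperbolic_pair[OF Bxz(2) QM[OF xy(2)] Qz(2)] by metis
    have "\<beta> \<noteq> 0" using \<beta>(3) by auto
    \<comment> \<open>Both pairs span the plane of \<open>x\<close> and \<open>y\<close>, so they
      have the same orthogonal complement.\<close>
    then have perp: "B w e = 0 \<and> B w f = 0 \<longleftrightarrow> B w e' = 0 \<and> B w f' = 0" for w
      unfolding ew ew' by (auto simp: z_def z'_def B_simps)
    define W' where "W' = {w \<in> W. B w e = 0 \<and> B w f = 0}"
    have W'perp: "B w e = 0" "B w f = 0" "B w e' = 0" "B w f' = 0" "B e w = 0" "B f w = 0"
      "B e' w = 0" "B f' w = 0" if "w \<in> W'" for w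
      using that perp[of w] B_commute by (auto simp: W'_def)
    have oW: "osub W" using W by (auto simp: osub_def osubmodule_def subspace_def)
    have eW: "e \<in> W" "f \<in> W" and eM: "e' \<in> M" "f' \<in> M"
      using eK[OF oW] eK'[OF oM] xy zM z'M MW NW by auto
    have eN: "I 0 (B n e)" "I 0 (B n f)" if "n \<in> N" for n
    proof -
      have "osub {u. I 0 (B n u)}"
        by (auto simp: osub_def osubmodule_def B_simps I_add I_mult_left)
      moreover have "I 0 (B n x)" using integral_sub_B[OF N that xy(1)] .
      moreover have "I 0 (B n z)" using small[OF that xy(2)] by (simp add: z_def B_simps)
      ultimately show "I 0 (B n e)" "I 0 (B n f)" using eK by blast+
    qed
    \<comment> \<open>\<open>p\<close> and \<open>p'\<close> are the orthogonal projection onto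
      \<open>W'\<close> written in two hyperbolic bases: the first has integral coefficients on
      \<open>N\<close>, the second keeps \<open>M\<close> inside \<open>M\<close>.\<close>
    define p where "p w = w - B w f *s e - B w e *s f" for w
    define p' where "p' w = w - B w f' *s e' - B w e' *s f'" for w
    have pW: "p w \<in> W'" if "w \<in> W" for w
      using that eW e W B_commute[of f e]
      by (simp add: W'_def p_def B_simps subspace_diff subspace_scale)
    have p'M: "p' m \<in> M \<inter> W'" if "m \<in> M" for m
    proof
      show "p' m \<in> M"
        using that eM integral_sub_B[OF M] oM by (simp add: p'_def osub_diff osub_scale)
      then show "p' m \<in> W'"
        using MW e' B_commute[of f' e'] perp[of "p' m"] by (auto simp: W'_def p'_def B_simps)
    qed
    have p_lin: "p (a + b) = p a + p b" "p (c *s a) = c *s p a" for a b c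
      by (simp_all add: p_def B_simps algebra_simps)
    have Qp: "Q w = 2 * (B w e * B w f) + Q (p w)" for w
      using e B_commute[of f e] B_commute[of e w] B_commute[of f w] by (simp add: p_def B_simps)
    have "\<exists>g. Vector_Spaces.linear (*s) (*s) g \<and> g ` W' \<subseteq> W' \<and> (\<forall>x\<in>W'. Q (g x) = Q x) \<and> g ` (p ` N) \<subseteq> M \<inter> W'"
    proof (rule Suc.IH)
      show "subspace W'"
        using W by (auto simp: W'_def subspace_def B_simps)
      \<comment> \<open>\<open>e\<close> pairs to 1 with \<open>f\<close>, which is orthogonal to
        \<open>T\<close>; adjoining \<open>e\<close> keeps independence, and the bound drops by
        one.\<close>
      show "finite T \<and> card T \<le> k" if T: "independent T" "T \<subseteq> W'" for T
      proof -
        have "span T \<subseteq> {w. B w f = 0}"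
          using T(2) W'perp(2) by (intro span_minimal) (auto simp: subspace_def B_simps)
        then have "e \<notin> span T" using e by auto
        then have "independent (insert e T)" using T by (intro independent_insertI)
        moreover have "insert e T \<subseteq> W" using T eW by (auto simp: W'_def)
        ultimately have "finite (insert e T) \<and> card (insert e T) \<le> Suc k" by (rule bound)
        moreover have "e \<notin> T" using \<open>e \<notin> span T\<close> span_base by blast
        ultimately show ?thesis by auto
      qed
      have "osub (M \<inter> W')"
        using oM W by (auto simp: W'_def osub_def osubmodule_def B_simps subspace_def)
      then show "integral_sub (M \<inter> W')" using QM by (simp add: integral_sub_def)
      have "osub (p ` N)"
        unfolding osub_def osubmodule_def
      proof (intro conjI ballI allI impI)
        show "0 \<in> p ` N" using osub_zero[OF oN] by (intro image_eqI[of _ _ 0]) (auto simp: p_def)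
        show "a + b \<in> p ` N" if "a \<in> p ` N" "b \<in> p ` N" for a b
          using that oN p_lin by (auto simp: osub_add simp flip: p_lin)
        show "c *s a \<in> p ` N" if "I 0 c" "a \<in> p ` N" for c a
          using that oN by (auto simp: osub_scale simp flip: p_lin)
      qed
      moreover have "I 0 (Q (p n))" if "n \<in> N" for n
      proof -
        have "Q (p n) = Q n - 2 * (B n e * B n f)" using Qp[of n] by simp
        then show ?thesis
          using eN[OF that] QN[OF that] val_unit_I[OF val_unit_2] by (auto intro!: I_diff I_mult_left)
      qed
      ultimately show "integral_sub (p ` N)" by (auto simp: integral_sub_def)
      show "p ` N \<subseteq> W'" using pW NW by blast
      show "a \<in> M \<inter> W'" if a: "a \<in> W'" "I 0 (Q a)" and am: "\<And>m. m \<in> M \<inter> W' \<Longrightarrow> I 0 (B a m)" for a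
      proof -
        have "a \<in> M"
        proof (rule max)
          show "a \<in> W" using a by (simp add: W'_def)
          show "I 0 (Q a)" by fact
          \<comment> \<open>\<open>a\<close> is orthogonal to the plane, so it pairs with
            \<open>m\<close> as it does with \<open>p' m\<close>, a vector of \<open>M\<close> in
            \<open>W'\<close>.\<close>
          show "I 0 (B a m)" if "m \<in> M" for m
            using am[OF p'M[OF that]] W'perp[OF a(1)] by (simp add: p'_def B_simps)
        qed
        then show ?thesis using a by simp
      qed
      show "I j (B a b)" if ab: "a \<in> p ` N" "b \<in> M \<inter> W'" for a b
      proof -
        obtain n where "n \<in> N" "a = p n" using ab by blast
        then show ?thesis using bdd[of n b] ab W'perp[of b] by (simp add: p_def B_simps)
      qed
    qed auto
    then obtain g where g: "Vector_Spaces.linear (*s) (*s) g" "g ` W' \<subseteq> W'" "\<forall>x\<in>W'. Q (g x) = Q x"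
      "g ` (p ` N) \<subseteq> M \<inter> W'" by blast
    \<comment> \<open>\<open>h\<close> carries \<open>e, f\<close> to \<open>e', f'\<close> and acts
      as \<open>g\<close> on the complement.\<close>
    define h where "h w = B w f *s e' + B w e *s f' + g (p w)" for w
    have "Vector_Spaces.linear (*s) (*s) h"
      by (rule linearI)
        (simp_all add: h_def p_lin linear_addD[OF g(1)] linear_scaleD[OF g(1)] B_simps algebra_simps)
    moreover have "h ` W \<subseteq> W"
    proof (rule image_subsetI)
      fix w assume "w \<in> W"
      then have "g (p w) \<in> W" using g(2) pW by (auto simp: W'_def)
      then show "h w \<in> W" using eM MW W by (auto simp: h_def intro!: subspace_add subspace_scale)
    qed
    moreover have "Q (h w) = Q w" if "w \<in> W" for w
    proof -
      have gp: "g (p w) \<in> W'" "Q (g (p w)) = Q (p w)" using g that pW by auto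
      then have "Q (h w) = 2 * (B w e * B w f) + Q (g (p w))"
        using e' B_commute[of f' e'] W'perp[OF gp(1)] by (simp add: h_def B_simps)
      then show ?thesis using Qp[of w] gp by simp
    qed
    moreover have "h ` N \<subseteq> M"
    proof (rule image_subsetI)
      fix n assume n: "n \<in> N"
      then have "g (p n) \<in> M" using g(4) by blast
      then show "h n \<in> M" using n eM eN oM by (auto simp: h_def intro!: osub_add osub_scale)
    qed
    ultimately show ?thesis by blast
  qed
qed

end

section \<open>Orthogonal frames\<close>

context quadratic_ambient
begin

definition frame :: "'v set \<Rightarrow> bool" where
  "frame X \<longleftrightarrow> finite X \<and> (\<forall>x\<in>X. Q x \<noteq> 0) \<and> (\<forall>x\<in>X. \<forall>y\<in>X. x \<noteq> y \<longrightarrow> B x y = 0)"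

definition unit_frame :: "'v set \<Rightarrow> bool" where
  "unit_frame X \<longleftrightarrow> frame X \<and> (\<forall>x\<in>X. val_unit (Q x))"

definition perp :: "'v set \<Rightarrow> 'v \<Rightarrow> bool" where
  "perp X z \<longleftrightarrow> (\<forall>x\<in>X. B z x = 0)"

definition proj :: "'v set \<Rightarrow> 'v \<Rightarrow> 'v" where
  "proj X z = z - (\<Sum>x\<in>X. (B z x / Q x) *s x)"

lemma perp_insert [simp]: "perp (insert a X) z \<longleftrightarrow> B z a = 0 \<and> perp X z"
  by (auto simp: perp_def)

lemma perp_empty [simp]: "perp {} z"
  by (simp add: perp_def)

lemma perp_add: "perp X x \<Longrightarrow> perp X y \<Longrightarrow> perp X (x + y)"
  and perp_scale: "perp X x \<Longrightarrow> perp X (c *s x)"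
  and perp_diff: "perp X x \<Longrightarrow> perp X y \<Longrightarrow> perp X (x - y)"
  by (auto simp: perp_def B_simps)

lemma frame_insert:
  assumes "frame X" "perp X z" "Q z \<noteq> 0"
  shows "frame (insert z X)" "z \<notin> X"
  using assms B_commute by (auto simp: frame_def perp_def)

lemma unit_frame_insert:
  assumes "unit_frame X" "perp X z" "val_unit (Q z)"
  shows "unit_frame (insert z X)" "z \<notin> X"
  using assms frame_insert[of X z] by (auto simp: unit_frame_def val_unit_nonzero)

lemma unit_frameD: "unit_frame X \<Longrightarrow> frame X" "unit_frame X \<Longrightarrow> finite X"
  by (auto simp: unit_frame_def frame_def)

lemma frame_sum:
  assumes "frame X" "x \<in> X" shows "B (\<Sum>y\<in>X. c y *s y) x = c x * Q x"
proof -
  have "B (\<Sum>y\<in>X. c y *s y) x = (\<Sum>y\<in>X. if y = x then c x * Q x else 0)"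
    unfolding B_sum_left using assms by (intro sum.cong) (auto simp: B_simps frame_def)
  then show ?thesis using assms by (simp add: frame_def)
qed

lemma proj_perp: "frame X \<Longrightarrow> perp X (proj X z)"
  by (auto simp: perp_def proj_def B_simps frame_sum) (auto simp: frame_def)

lemma B_proj: "perp X w \<Longrightarrow> B w (proj X z) = B w z"
  by (simp add: proj_def B_simps B_commute[of w "sum _ _"] B_sum_left)
     (simp add: perp_def B_commute[of _ w])

lemma span_frame_perp:
  assumes "frame X" "x \<in> span X" "perp X x" shows "x = 0"
proof -
  obtain c where c: "x = (\<Sum>y\<in>X. c y *s y)"
    using assms span_finite[of X] by (auto simp: frame_def)
  have "c y = 0" if "y \<in> X" for y
    using frame_sum[OF assms(1) that, of c] assms that by (auto simp: c perp_def frame_def)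
  then show ?thesis by (simp add: c)
qed

lemma frame_independent:
  assumes "frame X" shows "independent X"
proof -
  have "finite X" using assms by (simp add: frame_def)
  then show ?thesis
    using assms
  proof (induction X rule: finite_induct)
    case empty
    then show ?case by (simp add: independent_empty)
  next
    case (insert x X)
    have X: "frame X" "perp X x" "x \<noteq> 0" using insert by (auto simp: frame_def perp_def)
    then have "x \<notin> span X" using span_frame_perp by blast
    then show ?case using insert X by (intro independent_insertI)
  qed
qed

text \<open>Division by a unit norm keeps inner products integral, so a unit frame splits off
  orthogonally from an integral module that contains it.\<close>

lemma integral_sub_proj:
  assumes "integral_sub K" "unit_frame X" "X \<subseteq> K" "x \<in> K"
  shows "(\<Sum>y\<in>X. (B x y / Q y) *s y) \<in> K" "proj X x \<in> K"
proof -
  have K: "osub K" using assms by (simp add: integral_sub_def)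
  have "(B x y / Q y) *s y \<in> K" if "y \<in> X" for y
    using that assms integral_sub_B[of K x y] K
    by (auto intro!: osub_scale I_divide_unit simp: unit_frame_def)
  then show 1: "(\<Sum>y\<in>X. (B x y / Q y) *s y) \<in> K"
    using osubmodule_sum[of "(*s)" K X "\<lambda>y. (B x y / Q y) *s y"] K by (simp add: osub_def)
  show "proj X x \<in> K" using 1 assms K by (simp add: proj_def osub_diff)
qed

text \<open>\<open>K\<close> and \<open>M\<close> share the orthogonal summand generated by
  \<open>X\<close>; only the complements have to be compared.\<close>

lemma subset_if_perp_subset:
  assumes "integral_sub K" "integral_sub M" "unit_frame X" "X \<subseteq> M" "M \<subseteq> K"
    and "\<And>x. x \<in> K \<Longrightarrow> perp X x \<Longrightarrow> x \<in> M"
  shows "K \<subseteq> M"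
proof
  fix x assume x: "x \<in> K"
  have "proj X x \<in> K" using integral_sub_proj assms x by blast
  then have p: "proj X x \<in> M" using assms proj_perp unit_frameD(1) by blast
  have M: "osub M" using assms by (simp add: integral_sub_def)
  have "(B x y / Q y) *s y \<in> M" if "y \<in> X" for y
    using that assms integral_sub_B[of K x y] x M
    by (auto intro!: osub_scale I_divide_unit simp: unit_frame_def)
  then have "(\<Sum>y\<in>X. (B x y / Q y) *s y) \<in> M"
    using osubmodule_sum[of "(*s)" M X "\<lambda>y. (B x y / Q y) *s y"] M by (simp add: osub_def)
  then have "proj X x + (\<Sum>y\<in>X. (B x y / Q y) *s y) \<in> M" using p M by (intro osub_add)
  then show "x \<in> M" by (simp add: proj_def)
qed

section \<open>Reflections and transitivity on unit frames\<close>

definition isometry_on :: "'v set \<Rightarrow> ('v \<Rightarrow> 'v) \<Rightarrow> bool" where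
  "isometry_on M g \<longleftrightarrow> (\<forall>x y. B (g x) (g y) = B x y) \<and> g ` M \<subseteq> M"

definition reflection :: "'v \<Rightarrow> 'v \<Rightarrow> 'v" where
  "reflection u x = x - (2 * B x u / Q u) *s u"

lemma reflection_isometry:
  assumes "integral_sub M" "u \<in> M" "val_unit (Q u)"
  shows "isometry_on M (reflection u)"
  unfolding isometry_on_def
proof (intro conjI allI image_subsetI)
  have "Q u \<noteq> 0" using assms by (simp add: val_unit_def)
  then show "B (reflection u x) (reflection u y) = B x y" for x y
    by (simp add: reflection_def B_simps B_commute[of u y] field_simps)
  fix x assume "x \<in> M"
  then show "reflection u x \<in> M"
    using assms I_divide_unit[OF I_mult_left[OF val_unit_I[OF val_unit_2] integral_sub_B[of M x u]]]
    by (simp add: reflection_def integral_sub_def osub_diff osub_scale)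
qed

lemma reflection_fixes: "B x u = 0 \<Longrightarrow> reflection u x = x"
  by (simp add: reflection_def)

lemma reflection_swap:
  assumes "Q x = Q y" "Q (x - y) \<noteq> 0" shows "reflection (x - y) x = y"
proof -
  have "2 * B x (x - y) = Q (x - y)"
    using assms by (simp add: B_simps B_commute[of y x])
  then show ?thesis using assms(2) by (simp add: reflection_def)
qed

lemma isometry_on_comp: "isometry_on M g \<Longrightarrow> isometry_on M h \<Longrightarrow> isometry_on M (\<lambda>x. h (g x))"
  by (simp add: isometry_on_def image_subset_iff)

text \<open>One of \<open>Q (x - y)\<close>, \<open>Q (x + y)\<close> is a unit because their sum is \<open>4 Q x\<close>.\<close>

lemma unit_vector_transitive:
  assumes M: "integral_sub M" and xy: "x \<in> M" "y \<in> M" "Q x = Q y" "val_unit (Q y)"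
  obtains h where "isometry_on M h" "h x = y" "\<And>w. B w x = 0 \<Longrightarrow> B w y = 0 \<Longrightarrow> h w = w"
proof (cases "val_unit (Q (x - y))")
  case True
  have "x - y \<in> M" using xy M by (simp add: integral_sub_def osub_diff)
  then show thesis
    using that[of "reflection (x - y)"] reflection_isometry[OF M _ True] reflection_swap[of x y] xy
      val_unit_nonzero[OF True] by (simp add: reflection_fixes B_simps)
next
  case False
  \<comment> \<open>Writing the sum as \<open>x - (- y)\<close> lets \<open>reflection_swap\<close>
    carry \<open>x\<close> to \<open>- y\<close>; the reflection in \<open>y\<close> then removes
    the sign.\<close>
  have d: "x - y \<in> M" "x - (- y) \<in> M"
    using xy M osub_add[of M x y] by (simp_all add: integral_sub_def osub_diff)
  have "val_unit (Q (x - (- y)))"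
  proof (rule ccontr)
    assume n: "\<not> val_unit (Q (x - (- y)))"
    then have "I 1 (Q (x - y) + Q (x - (- y)))"
      using False d M by (intro I_add) (auto simp: val_unit_iff integral_sub_def)
    also have "Q (x - y) + Q (x - (- y)) = 2 * 2 * Q y"
      using xy by (simp add: B_simps B_commute[of y x])
    finally show False using val_unit_mult[OF val_unit_mult[OF val_unit_2 val_unit_2] xy(4)]
      by (simp add: val_unit_iff)
  qed
  note u = this
  have "isometry_on M (\<lambda>w. reflection y (reflection (x - (- y)) w))"
    using reflection_isometry[OF M d(2) u] reflection_isometry[OF M xy(2,4)]
    by (rule isometry_on_comp)
  moreover have "reflection (x - (- y)) x = - y"
    using xy u by (intro reflection_swap) (simp_all add: B_simps val_unit_nonzero)
  then have "reflection y (reflection (x - (- y)) x) = y"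
    using val_unit_nonzero[OF xy(4)] scale_left_distrib[of 1 1 y]
    by (simp add: reflection_def B_simps)
  ultimately show thesis
    by (rule that) (simp add: reflection_fixes B_simps)
qed

text \<open>Induction over the frame. Once \<open>X\<close> is back in place, the image of the next
  vector and that vector itself are both orthogonal to \<open>X\<close>, so the isometry carrying
  one to the other fixes \<open>X\<close>.\<close>

lemma unit_frame_transitive:
  assumes M: "integral_sub M" and "unit_frame X" "X \<subseteq> M" "\<phi> ` X \<subseteq> M"
    and "\<And>x y. x \<in> X \<Longrightarrow> y \<in> X \<Longrightarrow> B (\<phi> x) (\<phi> y) = B x y"
  shows "\<exists>g. isometry_on M g \<and> (\<forall>x\<in>X. g (\<phi> x) = x)"
  using unit_frameD(2)[OF assms(2)] assms(2-)
proof (induction X rule: finite_induct)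
  case empty
  show ?case by (rule exI[of _ "\<lambda>x. x"]) (simp add: isometry_on_def)
next
  case (insert a X)
  have "unit_frame X" and pa: "perp X a" and a: "val_unit (Q a)" "a \<in> M"
    using insert by (auto simp: unit_frame_def frame_def perp_def)
  then obtain g where g: "isometry_on M g" "\<forall>x\<in>X. g (\<phi> x) = x" using insert by auto
  have gB: "B (g x) (g y) = B x y" for x y using g by (simp add: isometry_on_def)
  have "g (\<phi> a) \<in> M" using g insert by (auto simp: isometry_on_def)
  moreover have "Q (g (\<phi> a)) = Q a" using insert gB by simp
  ultimately obtain h where h: "isometry_on M h" "h (g (\<phi> a)) = a"
      "\<And>w. B w (g (\<phi> a)) = 0 \<Longrightarrow> B w a = 0 \<Longrightarrow> h w = w"
    using unit_vector_transitive[OF M _ a(2) _ a(1)] by metis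
  have "h x = x" if "x \<in> X" for x
  proof (rule h(3))
    show "B x a = 0" using pa that B_commute by (metis perp_def)
    have "B (g (\<phi> x)) (g (\<phi> a)) = B x a" using gB insert.prems(4) that by simp
    then show "B x (g (\<phi> a)) = 0" using g(2) that \<open>B x a = 0\<close> by simp
  qed
  then show ?case
    using isometry_on_comp[OF g(1) h(1)] g(2) h(2) by (intro exI[of _ "\<lambda>x. h (g x)"]) auto
qed

lemma span_scale_into:
  assumes "osub M" "x \<in> span M"
  shows "\<exists>j. \<pi> ^ j *s x \<in> M"
  using assms(2)
proof (induction x rule: span_induct_alt)
  case base
  show ?case using osub_zero[OF assms(1)] by simp
next
  case (step c x y)
  then obtain j where j: "\<pi> ^ j *s y \<in> M" by blast
  \<comment> \<open>The power of \<open>\<pi>\<close> that clears the denominator of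
    \<open>c\<close>. For \<open>c = 0\<close> the value of \<open>v c\<close> is arbitrary, but
    then the product is 0.\<close>
  define i where "i = nat (- v c)"
  have "I 0 (\<pi> ^ j * (\<pi> ^ i * c))"
    by (cases "c = 0") (auto simp: val_ge_def val_mult i_def)
  then have 1: "(\<pi> ^ j * (\<pi> ^ i * c)) *s x \<in> M" using step assms by (intro osub_scale)
  have "I 0 (\<pi> ^ i)" by (simp add: val_ge_def)
  then have "\<pi> ^ i *s \<pi> ^ j *s y \<in> M" by (rule osub_scale[OF assms(1) _ j])
  with 1 have "(\<pi> ^ j * (\<pi> ^ i * c)) *s x + \<pi> ^ i *s \<pi> ^ j *s y \<in> M"
    using assms by (intro osub_add)
  also have "(\<pi> ^ j * (\<pi> ^ i * c)) *s x + \<pi> ^ i *s \<pi> ^ j *s y = \<pi> ^ (i + j) *s (c *s x + y)"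
    by (simp add: scale_right_distrib power_add algebra_simps)
  finally show ?case by blast
qed

end

section \<open>ADC lattices inside maximal integral submodules\<close>

text \<open>\<open>V\<close> stands for \<open>FM\<close> and \<open>K\<close> for a maximal
  integral submodule above \<open>M\<close>; the aim is that \<open>K\<close> lies in
  \<open>M\<close>. ADC is reduced to test lattices with an orthogonal basis of \<open>n - 1\<close>
  unit norms and one more nonzero integral norm.\<close>

locale adc_pair = quadratic_ambient v scale B
  for v :: "'f::field \<Rightarrow> int" and scale :: "'f \<Rightarrow> 'v::ab_group_add \<Rightarrow> 'v" (infixr \<open>*s\<close> 75)
    and B :: "'v \<Rightarrow> 'v \<Rightarrow> 'f" +
  fixes V M K :: "'v set" and n :: nat
  assumes subspace_V: "subspace V"
    and finite_V: "\<exists>S. finite S \<and> V = span S"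
    and nondegenerate_V: "nondegenerate B V"
    and n_ge_2: "2 \<le> n"
    and dim_V: "dim V = n + 1 \<or> dim V = n + 2"
    and integral_M: "integral_sub M" and integral_K: "integral_sub K"
    and M_subset_K: "M \<subseteq> K" and K_subset_V: "K \<subseteq> V" and span_M: "span M = V"
    and K_maximal: "\<And>x. x \<in> V \<Longrightarrow> I 0 (Q x) \<Longrightarrow> (\<And>k. k \<in> K \<Longrightarrow> I 0 (B x k)) \<Longrightarrow> x \<in> K"
    and adc: "\<And>X z. unit_frame X \<Longrightarrow> X \<subseteq> V \<Longrightarrow> card X = n - 1 \<Longrightarrow> z \<in> V \<Longrightarrow> perp X z \<Longrightarrow>
        Q z \<noteq> 0 \<Longrightarrow> I 0 (Q z) \<Longrightarrow>
        \<exists>\<phi>. \<phi> ` insert z X \<subseteq> M \<and> (\<forall>x\<in>insert z X. \<forall>y\<in>insert z X. B (\<phi> x) (\<phi> y) = B x y)"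
begin

lemma osub_M: "osub M" and osub_K: "osub K"
  using integral_M integral_K by (simp_all add: integral_sub_def)

lemma Q_K: "x \<in> K \<Longrightarrow> I 0 (Q x)"
  using integral_K by (simp add: integral_sub_def)

lemma basis_V: obtains b where "finite b" "independent b" "b \<subseteq> V" "V = span b" "card b = dim V"
proof -
  obtain b where b: "b \<subseteq> V" "independent b" "V \<subseteq> span b" "card b = dim V"
    using basis_exists[of V] by blast
  obtain S where "finite S" "V = span S" using finite_V by blast
  then have "finite b" using independent_span_bound[of S b] b by blast
  moreover have "V = span b" using b span_minimal[OF b(1) subspace_V] by blast
  ultimately show thesis using that b by blast
qed

lemma frame_card_le: "frame X \<Longrightarrow> X \<subseteq> V \<Longrightarrow> card X \<le> dim V"
  using basis_V frame_independent independent_span_bound by metis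

lemma frame_full:
  assumes X: "frame X" "X \<subseteq> V" "card X = dim V" and x: "x \<in> V" "perp X x"
  shows "x = 0"
proof (rule ccontr)
  assume "x \<noteq> 0"
  then have nx: "x \<notin> span X" using span_frame_perp[OF X(1) _ x(2)] by blast
  then have ind: "independent (insert x X)"
    using frame_independent[OF X(1)] by (intro independent_insertI)
  obtain b where b: "finite b" "V = span b" "card b = dim V" by (rule basis_V)
  have "finite (insert x X) \<and> card (insert x X) \<le> card b"
    using b X x by (intro independent_span_bound[OF b(1) ind]) auto
  moreover have "x \<notin> X" using nx span_base by blast
  ultimately show False using b X by auto
qed

text \<open>The complement of a frame is nondegenerate, so it has a vector of nonzero norm, and a
  scalar brings the valuation of that norm to 0 or 1.\<close>

lemma frame_extend:
  assumes X: "frame X" "X \<subseteq> V" "card X < dim V"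
  obtains z where "z \<in> V" "perp X z" "Q z \<noteq> 0" "val_unit (Q z) \<or> val_prime (Q z)"
proof -
  have "\<not> V \<subseteq> span X"
    using X dim_le_card[of V X] by (auto simp: frame_def)
  then obtain x where x: "x \<in> V" "x \<notin> span X" by blast
  have pV: "proj X y \<in> V" if "y \<in> V" for y
    unfolding proj_def using that X subspace_V
    by (auto intro!: subspace_diff subspace_sum subspace_scale)
  define a where "a = proj X x"
  have a: "a \<in> V" "perp X a" using pV[OF x(1)] proj_perp[OF X(1)] by (auto simp: a_def)
  have "a \<noteq> 0"
  proof
    assume "a = 0"
    then have "x = (\<Sum>y\<in>X. (B x y / Q y) *s y)" by (simp add: a_def proj_def)
    then show False using x(2) by (metis (no_types, lifting) span_base span_scale span_sum)
  qed
  then obtain y where y: "y \<in> V" "B a y \<noteq> 0"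
    using nondegenerate_V a by (auto simp: nondegenerate_def)
  \<comment> \<open>Projecting \<open>y\<close> does not change its pairing with \<open>a\<close>;
    two isotropic vectors with nonzero pairing have an anisotropic sum.\<close>
  define b where "b = proj X y"
  have b: "b \<in> V" "perp X b" "B a b \<noteq> 0"
    using pV[OF y(1)] proj_perp[OF X(1)] B_proj[OF a(2), of y] y by (auto simp: b_def)
  have "\<exists>z\<in>V. perp X z \<and> Q z \<noteq> 0"
  proof (rule ccontr)
    assume "\<not> ?thesis"
    moreover have "a + b \<in> V" "perp X (a + b)" using a b subspace_V by (auto simp: subspace_add perp_add)
    ultimately have "Q a = 0" "Q b = 0" "Q (a + b) = 0" using a b by auto
    then have "2 * B a b = 0" by (simp add: polarization)
    then show False using b by simp
  qed
  then obtain z where z: "z \<in> V" "perp X z" "Q z \<noteq> 0" by blast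
  obtain c where c: "c \<noteq> 0" "v (c * c * Q z) = 0 \<or> v (c * c * Q z) = 1"
    using exists_scale_val_0_1[OF z(3)] .
  have "Q (c *s z) = c * c * Q z" by (simp add: B_simps)
  then show thesis
    using that[of "c *s z"] c z subspace_V
    by (simp add: subspace_scale perp_scale val_unit_def val_prime_iff)
qed

text \<open>ADC gives a copy of \<open>X\<close> and \<open>z\<close> somewhere in \<open>M\<close>.
  By \<open>unit_frame_transitive\<close> an isometry moves the copy of \<open>X\<close> back onto
  \<open>X\<close>, so the norm of \<open>z\<close> is represented in the complement of this very
  frame.\<close>

lemma adc_test:
  assumes X: "unit_frame X" "X \<subseteq> M" "card X = n - 1"
    and z: "z \<in> V" "perp X z" "Q z \<noteq> 0" "I 0 (Q z)"
  obtains y where "y \<in> M" "perp X y" "Q y = Q z"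
proof -
  obtain \<phi> where \<phi>: "\<phi> ` insert z X \<subseteq> M"
      "\<And>x y. x \<in> insert z X \<Longrightarrow> y \<in> insert z X \<Longrightarrow> B (\<phi> x) (\<phi> y) = B x y"
    using adc[OF X(1) _ X(3) z] X M_subset_K K_subset_V by (metis subset_trans)
  obtain g where g: "isometry_on M g" "\<forall>x\<in>X. g (\<phi> x) = x"
    using unit_frame_transitive[OF integral_M X(1,2), of \<phi>] \<phi> by auto
  have gB: "B (g x) (g y) = B x y" for x y using g by (simp add: isometry_on_def)
  show thesis
  proof (rule that[of "g (\<phi> z)"])
    show "g (\<phi> z) \<in> M" using g \<phi> by (auto simp: isometry_on_def)
    show "Q (g (\<phi> z)) = Q z" using gB \<phi>(2) by simp
    show "perp X (g (\<phi> z))"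
      unfolding perp_def
    proof
      fix x assume x: "x \<in> X"
      have "B (g (\<phi> z)) (g (\<phi> x)) = B z x" using gB \<phi>(2) x by simp
      then show "B (g (\<phi> z)) x = 0" using g x z by (simp add: perp_def)
    qed
  qed
qed

section \<open>Saturated unit frames\<close>

text \<open>Such a frame is a basis of the unimodular component in a Jordan splitting of
  \<open>K\<close>.\<close>

definition saturated :: "'v set \<Rightarrow> bool" where
  "saturated X \<longleftrightarrow> unit_frame X \<and> X \<subseteq> K \<and> (\<forall>x\<in>K. perp X x \<longrightarrow> I 1 (Q x))"

lemma not_saturated:
  assumes "unit_frame X" "X \<subseteq> K" "\<not> saturated X"
  obtains y where "y \<in> K" "perp X y" "val_unit (Q y)"
  using assms Q_K by (auto simp: saturated_def val_unit_iff)

lemma saturated_exists: "\<exists>X. saturated X"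
proof -
  have "\<exists>Y. saturated Y" if "unit_frame X" "X \<subseteq> K" for X
    using that
  proof (induction "dim V - card X" arbitrary: X rule: less_induct)
    case less
    show ?case
    proof (cases "saturated X")
      case False
      then obtain y where y: "y \<in> K" "perp X y" "val_unit (Q y)"
        using not_saturated less by blast
      have i: "unit_frame (insert y X)" "y \<notin> X" using unit_frame_insert less y by blast+
      have "card (insert y X) = Suc (card X)" using i less unit_frameD(2) by auto
      moreover have "card (insert y X) \<le> dim V"
        using i less y K_subset_V by (intro frame_card_le unit_frameD) auto
      ultimately show ?thesis using less(1)[of "insert y X"] i less(3) y by auto
    qed blast
  qed
  from this[of "{}"] show ?thesis by (auto simp: unit_frame_def frame_def)
qed

lemma saturated_B:
  assumes "saturated X" "x \<in> K" "y \<in> K" "perp X x" "perp X y" shows "I 1 (B x y)"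
proof (rule B_I[of "{x \<in> K. perp X x}"])
  show "osub {x \<in> K. perp X x}"
    using osub_K by (auto simp: osub_def osubmodule_def perp_add perp_scale) (simp add: perp_def)
qed (use assms in \<open>auto simp: saturated_def\<close>)

text \<open>Descent on the power of \<open>\<pi>\<close> needed to enter \<open>K\<close>:
  saturation puts the pairings of \<open>\<pi>\<close> times a vector with \<open>K\<close> into the
  maximal ideal, so the vector itself pairs integrally with \<open>K\<close> and maximality
  applies.\<close>

lemma saturated_perp_in_K:
  assumes X: "saturated X" and x: "x \<in> V" "perp X x" "I 0 (Q x)"
  shows "x \<in> K"
proof -
  have "x \<in> K" if "\<pi> ^ j *s x \<in> K" for j
    using that
  proof (induction j)
    case (Suc j)
    have "\<pi> ^ j *s x \<in> K"
    proof (rule K_maximal)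
      show "\<pi> ^ j *s x \<in> V" using x subspace_V by (simp add: subspace_scale)
      have "I 0 (\<pi> ^ j)" by (simp add: val_ge_def)
      then show "I 0 (Q (\<pi> ^ j *s x))" using x by (simp add: B_simps I_mult_left)
      fix k assume k: "k \<in> K"
      have "I 1 (B (\<pi> ^ Suc j *s x) (proj X k))"
        using X x Suc integral_sub_proj[OF integral_K _ _ k, of X] proj_perp[of X k] unit_frameD
        by (intro saturated_B[OF X]) (auto simp: saturated_def perp_scale)
      then have "I 1 (B (\<pi> ^ Suc j *s x) k)"
        using x by (simp add: B_proj perp_scale)
      then have "I 1 (\<pi> * B (\<pi> ^ j *s x) k)" by (simp add: B_simps mult.assoc)
      then show "I 0 (B (\<pi> ^ j *s x) k)"
        using I_divide[of 1 "\<pi> * B (\<pi> ^ j *s x) k" \<pi>] by simp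
    qed
    then show ?case by (rule Suc.IH)
  qed simp
  moreover obtain j where "\<pi> ^ j *s x \<in> M"
    using span_scale_into[OF osub_M] x span_M by blast
  ultimately show ?thesis using M_subset_K by blast
qed

text \<open>The vector from \<open>frame_extend\<close> lies in \<open>K\<close> by
  \<open>saturated_perp_in_K\<close>, and there saturation rules out unit norms.\<close>

lemma saturated_perp_extend:
  assumes X: "saturated X" and Y: "frame (Y \<union> X)" "Y \<union> X \<subseteq> V" "card (Y \<union> X) < dim V"
  obtains z where "z \<in> V" "z \<in> K" "perp (Y \<union> X) z" "val_prime (Q z)"
proof -
  obtain z where z: "z \<in> V" "perp (Y \<union> X) z" "val_unit (Q z) \<or> val_prime (Q z)"
    using frame_extend[OF Y] by metis
  have p: "perp X z" using z by (simp add: perp_def)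
  have "I 0 (Q z)" using z I_mono[of 1 "Q z" 0] by (auto simp: val_unit_iff val_prime_def)
  then have "z \<in> K" using saturated_perp_in_K[OF X z(1) p] by blast
  moreover have "val_prime (Q z)"
    using z X p calculation by (auto simp: saturated_def val_unit_iff)
  ultimately show thesis using that z by blast
qed

text \<open>Three orthogonal vectors of prime norm in the complement would give, after division by
  \<open>\<pi>\<close>, a ternary form over a finite field, which has a nontrivial zero.\<close>

lemma saturated_card:
  assumes X: "saturated X" shows "dim V \<le> card X + 2"
proof (rule ccontr)
  assume neg: "\<not> ?thesis"
  have fX: "frame X" "X \<subseteq> V" "finite X"
    using X K_subset_V unit_frameD by (auto simp: saturated_def)
  obtain a where a: "a \<in> V" "a \<in> K" "perp X a" "val_prime (Q a)"
    using saturated_perp_extend[OF X, of "{}"] fX neg by auto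
  have fa: "frame (insert a X)" "a \<notin> X"
    using frame_insert[OF fX(1) a(3)] a(4) by (auto simp: val_prime_iff)
  obtain b where b: "b \<in> V" "b \<in> K" "perp (insert a X) b" "val_prime (Q b)"
    using saturated_perp_extend[OF X, of "{a}"] fX neg a fa by auto
  have fb: "frame (insert b (insert a X))" "b \<notin> insert a X"
    using frame_insert[OF fa(1) b(3)] b(4) by (auto simp: val_prime_iff)
  obtain c where c: "c \<in> V" "c \<in> K" "perp (insert b (insert a X)) c" "val_prime (Q c)"
    using saturated_perp_extend[OF X, of "{b, a}"] fX neg a b fa fb by auto
  have ua: "val_unit (Q a / \<pi>)" "val_unit (Q b / \<pi>)" "val_unit (Q c / \<pi>)"
    using a b c by (auto intro: val_prime_over_pi)
  obtain x y where xy: "I 0 x" "I 0 y" "I 1 (Q a / \<pi> * (x * x) + Q b / \<pi> * (y * y) - - (Q c / \<pi>))"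
    using binary_form_residue_surj[OF ua(1,2), of "- (Q c / \<pi>)"] ua(3) val_unit_I by auto
  \<comment> \<open>The zero makes the norm of \<open>w\<close> integral, so \<open>w\<close> lies
    in \<open>K\<close>; but \<open>B w c = Q c / \<pi>\<close> is a unit, against
    \<open>saturated_B\<close>.\<close>
  define w where "w = (1 / \<pi>) *s (x *s a + y *s b + c)"
  have orth: "B a b = 0" "B b a = 0" "B a c = 0" "B c a = 0" "B b c = 0" "B c b = 0"
    using b c B_commute by auto
  have "w \<in> K"
  proof (rule saturated_perp_in_K[OF X])
    show "w \<in> V" using a b c subspace_V by (auto simp: w_def intro!: subspace_scale subspace_add)
    show "perp X w" using a b c by (simp add: w_def perp_scale perp_add)
    have "Q w = (Q a / \<pi> * (x * x) + Q b / \<pi> * (y * y) - - (Q c / \<pi>)) / \<pi>"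
      by (simp add: w_def B_simps orth field_simps)
    then show "I 0 (Q w)" using I_divide[OF xy(3), of \<pi>] by simp
  qed
  moreover have "perp X w" "perp X c" using a b c by (simp_all add: w_def perp_scale perp_add)
  ultimately have "I 1 (B w c)" using saturated_B[OF X] c by blast
  moreover have "B w c = Q c / \<pi>" by (simp add: w_def B_simps orth)
  ultimately show False using ua(3) by (simp add: val_unit_iff)
qed

text \<open>The complement of \<open>X\<close> has rank at most 2, and vectors of \<open>K\<close>
  have integral coordinates in an orthogonal basis of prime norms there. Such a basis has to be
  found in \<open>M\<close>; norms modulo the square of the maximal ideal suffice for that.\<close>

lemma saturated_imp_subset:
  assumes X: "saturated X" "X \<subseteq> M"
    and test: "\<And>z. z \<in> V \<Longrightarrow> perp X z \<Longrightarrow> val_prime (Q z) \<Longrightarrow> \<exists>m\<in>M. perp X m \<and> I 2 (Q z - Q m)"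
  shows "K \<subseteq> M"
proof (rule subset_if_perp_subset[OF integral_K integral_M _ X(2) M_subset_K])
  show "unit_frame X" using X by (simp add: saturated_def)
  fix x assume x: "x \<in> K" "perp X x"
  have xV: "x \<in> V" using x K_subset_V by blast
  have fX: "frame X" "X \<subseteq> V" "finite X"
    using X K_subset_V unit_frameD by (auto simp: saturated_def)
  have coeff: "I 0 (B k m / Q m)" if "k \<in> K" "perp X k" "m \<in> K" "perp X m" "val_prime (Q m)" for k m
    using I_divide[OF saturated_B[OF X(1) that(1,3,2,4)], of "Q m"] that(5) by (simp add: val_prime_iff)
  show "x \<in> M"
  proof (cases "card X = dim V")
    case True
    then have "x = 0" using frame_full[OF fX(1,2) _ xV x(2)] by simp
    then show ?thesis using osub_zero[OF osub_M] by simp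
  next
    case False
    then have "card X < dim V" using frame_card_le[OF fX(1,2)] by simp
    then obtain k where k: "k \<in> V" "perp X k" "val_prime (Q k)"
      using saturated_perp_extend[OF X(1), of "{}"] fX by auto
    then obtain m where m: "m \<in> M" "perp X m" "I 2 (Q k - Q m)" using test by blast
    have pm: "val_prime (Q m)" using val_prime_cong k(3) m(3) by blast
    have m0: "Q m \<noteq> 0" using pm by (simp add: val_prime_iff)
    have mK: "m \<in> K" "m \<in> V" using m M_subset_K K_subset_V by auto
    have fm: "frame (insert m X)" "m \<notin> X" using frame_insert[OF fX(1) m(2) m0] .
    show ?thesis
    proof (cases "card (insert m X) = dim V")
      case True
      have "x - (B x m / Q m) *s m = 0"
        using x xV m mK m0 fX subspace_V
        by (intro frame_full[OF fm(1) _ True]) 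
          (auto intro!: subspace_diff subspace_scale perp_diff perp_scale simp: B_simps)
      then have "x = (B x m / Q m) *s m" by simp
      moreover have "(B x m / Q m) *s m \<in> M"
        using coeff[OF x mK(1) m(2) pm] m osub_M by (intro osub_scale)
      ultimately show ?thesis by simp
    next
      case False
      then have "card (insert m X) < dim V"
        using frame_card_le[OF fm(1)] fX mK by simp
      then obtain z where z: "z \<in> V" "z \<in> K" "perp (insert m X) z" "val_prime (Q z)"
        using saturated_perp_extend[OF X(1), of "{m}"] fm fX mK by auto
      have z0: "Q z \<noteq> 0" using z by (simp add: val_prime_iff)
      have fz: "frame (insert z (insert m X))" "z \<notin> insert m X" using frame_insert[OF fm(1) z(3) z0] .
      have card: "card (insert z (insert m X)) = dim V"
        using saturated_card[OF X(1)] frame_card_le[OF fz(1)] fX mK z fm fz by simp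
      have orth: "B z m = 0" "B m z = 0" "perp X z" using z B_commute by auto
      have expand: "u = (B u m / Q m) *s m + (B u z / Q z) *s z" if "u \<in> V" "perp X u" for u
      proof -
        have "u - (B u m / Q m) *s m - (B u z / Q z) *s z = 0"
          using that m mK z m0 z0 orth fX subspace_V
          by (intro frame_full[OF fz(1) _ card]) 
            (auto intro!: subspace_diff subspace_scale perp_diff perp_scale simp: B_simps)
        then show ?thesis by (simp add: algebra_simps)
      qed
      obtain \<Delta> where \<Delta>: "val_unit \<Delta>" "\<And>t. I 0 t \<Longrightarrow> \<not> I 1 (t * t - \<Delta>)" by (rule residue_nonsquare) blast
      have um: "val_unit (Q m / \<pi>)" "val_unit (Q z / \<pi>)"
        using pm z by (auto intro: val_prime_over_pi)
      \<comment> \<open>\<open>y\<close> receives a norm congruent to \<open>\<Delta> * Q m\<close>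
        with \<open>\<Delta>\<close> a non-square. No integral multiple of \<open>m\<close> has such
        a norm, so the vector of \<open>M\<close> representing it must involve
        \<open>z\<close>.\<close>
      obtain \<alpha> \<beta> where ab: "I 0 \<alpha>" "I 0 \<beta>"
          "I 1 (Q m / \<pi> * (\<alpha> * \<alpha>) + Q z / \<pi> * (\<beta> * \<beta>) - \<Delta> * (Q m / \<pi>))"
        using binary_form_residue_surj[OF um, of "\<Delta> * (Q m / \<pi>)"] val_unit_mult[OF \<Delta>(1) um(1)] val_unit_I
        by auto
      define y where "y = \<alpha> *s m + \<beta> *s z"
      have y: "y \<in> V" "perp X y"
        using m mK z orth subspace_V by (auto simp: y_def subspace_add subspace_scale perp_add perp_scale)
      have "Q y - \<Delta> * Q m = \<pi> * (Q m / \<pi> * (\<alpha> * \<alpha>) + Q z / \<pi> * (\<beta> * \<beta>) - \<Delta> * (Q m / \<pi>))"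
        by (simp add: y_def B_simps orth field_simps)
      then have Qy: "I 2 (Q y - \<Delta> * Q m)" using ab by (simp add: I_2_pi_iff)
      have "val_prime (\<Delta> * Q m)" using pm \<Delta>(1) by (simp add: val_prime_def I_mult_unit_iff)
      then have "val_prime (Q y)" using Qy I_diff_commute val_prime_cong by blast
      then obtain m2 where m2: "m2 \<in> M" "perp X m2" "I 2 (Q y - Q m2)" using test y by blast
      have m2K: "m2 \<in> K" "m2 \<in> V" using m2 M_subset_K K_subset_V by auto
      define a b where "a = B m2 m / Q m" and "b = B m2 z / Q z"
      have ab': "I 0 a" "I 0 b"
        using coeff[OF m2K(1) m2(2) mK(1) m(2) pm] coeff[OF m2K(1) m2(2) z(2) orth(3) z(4)]
        by (auto simp: a_def b_def)
      have m2e: "m2 = a *s m + b *s z" using expand[OF m2K(2) m2(2)] by (simp add: a_def b_def)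
      \<comment> \<open>Otherwise the \<open>z\<close> part vanishes modulo the square of the
        maximal ideal, and \<open>\<Delta>\<close> is congruent to \<open>a * a\<close>.\<close>
      have "\<not> I 1 b"
      proof
        assume "I 1 b"
        then have "I 2 (b * b)" using I_mult[of 1 b 1 b] by simp
        then have "I 2 (b * b * Q z)"
          by (rule I_mult_right) (use Q_K z in blast)
        moreover have "Q m2 = a * a * Q m + b * b * Q z" by (subst (1 2) m2e) (simp add: B_simps orth)
        moreover have "I 2 (\<Delta> * Q m - Q m2)" using Qy m2(3) I_trans I_diff_commute by blast
        ultimately have "I 2 (\<Delta> * Q m - (a * a * Q m + b * b * Q z) + b * b * Q z)"
          by (metis I_add)
        moreover have "\<Delta> * Q m - (a * a * Q m + b * b * Q z) + b * b * Q z = \<pi> * ((Q m / \<pi>) * (\<Delta> - a * a))"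
          by (simp add: field_simps)
        ultimately have "I 1 (\<Delta> - a * a)" using I_2_pi_iff I_mult_unit_iff[OF um(1)] by metis
        then show False using \<Delta>(2)[OF ab'(1)] I_diff_commute by blast
      qed
      then have ub: "val_unit b" using ab' by (simp add: val_unit_iff)
      then have "z = inverse b *s (m2 - a *s m)"
        using val_unit_nonzero[OF ub] by (simp add: m2e)
      moreover have "inverse b *s (m2 - a *s m) \<in> M"
        using m m2 ab' osub_M val_unit_I[OF val_unit_inverse[OF ub]] by (intro osub_scale osub_diff) auto
      ultimately have "z \<in> M" by simp
      moreover have "I 0 (B x m / Q m)" "I 0 (B x z / Q z)"
        using coeff[OF x mK(1) m(2) pm] coeff[OF x z(2) orth(3) z(4)] .
      ultimately have "(B x m / Q m) *s m + (B x z / Q z) *s z \<in> M"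
        using m osub_M by (intro osub_add osub_scale)
      then show ?thesis using expand[OF xV x(2)] by simp
    qed
  qed
qed

text \<open>
  If \<open>b, w\<close> span a plane that is hyperbolic modulo the maximal ideal, then exchanging one vector
  \<open>a \<in> X\<close> with a vector of that plane whose norm is a non-square multiple of \<open>Q a\<close> makes the plane
  anisotropic. This is where \<open>n \<ge> 2\<close> enters.
\<close>

lemma anisotropic_completion:
  assumes X: "unit_frame X" "X \<subseteq> M" "card X = n - 1"
    and b: "b \<in> M" "perp X b" "val_unit (Q b)"
    and w: "w \<in> M" "perp (insert b X) w" "val_unit (Q w)"
  obtains X' b' w' where "unit_frame X'" "X' \<subseteq> M" "card X' = n - 1"
    "b' \<in> M" "perp X' b'" "val_unit (Q b')"
    "w' \<in> M" "perp (insert b' X') w'" "val_unit (Q w')"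
    "\<And>t. I 0 t \<Longrightarrow> \<not> I 1 (t * t + Q b' * Q w')"
proof (cases "\<exists>t. I 0 t \<and> I 1 (t * t + Q b * Q w)")
  case False
  then show thesis using that[OF X b w] by blast
next
  case True
  then obtain t where t: "I 0 t" "I 1 (t * t + Q b * Q w)" by blast
  have "X \<noteq> {}" using X n_ge_2 by auto
  then obtain a where a: "a \<in> X" by blast
  have ua: "val_unit (Q a)" and aM: "a \<in> M" using X a by (auto simp: unit_frame_def)
  define Y where "Y = X - {a}"
  have Y: "unit_frame Y" "Y \<subseteq> M" "perp Y a" "X = insert a Y" "a \<notin> Y" "finite Y"
    using X a unit_frameD(2)[OF X(1)] by (auto simp: Y_def unit_frame_def frame_def perp_def)
  obtain \<Delta> where \<Delta>: "val_unit \<Delta>" "\<And>t. I 0 t \<Longrightarrow> \<not> I 1 (t * t - \<Delta>)"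
    by (rule residue_nonsquare) blast
  obtain x y where xy: "I 0 x" "I 0 y" "I 1 (Q b * (x * x) + Q w * (y * y) - \<Delta> * Q a)"
    using binary_form_residue_surj[OF b(3) w(3), of "\<Delta> * Q a"] val_unit_I[OF val_unit_mult[OF \<Delta>(1) ua]]
    by auto
  define h where "h = x *s b + y *s w"
  \<comment> \<open>\<open>h'\<close> is orthogonal to \<open>h\<close> in the plane of
    \<open>b\<close> and \<open>w\<close>; its norm is \<open>Q h\<close> times the determinant of
    that plane.\<close>
  define h' where "h' = (- (y * Q w)) *s b + (x * Q b) *s w"
  have orth: "B w b = 0" "B b w = 0" "B b a = 0" "B w a = 0" "perp Y b" "perp Y w"
    using b w B_commute Y(4) by auto
  have Qh: "Q h = Q b * (x * x) + Q w * (y * y)"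
    by (simp add: h_def B_simps orth algebra_simps)
  have Qh': "Q h' = Q b * Q w * Q h"
    by (simp add: Qh h'_def B_simps orth algebra_simps)
  have uh: "val_unit (Q h)"
    using val_unit_cong[OF val_unit_mult[OF \<Delta>(1) ua], of "Q h"] xy(3) I_diff_commute[of 1 "Q h"]
    by (simp add: Qh)
  have uh': "val_unit (Q h')" using Qh' uh b w by (simp add: val_unit_mult)
  have hM: "h \<in> M" "h' \<in> M"
    using b w xy osub_M val_unit_I I_mult_left
    by (auto simp: h_def h'_def intro!: osub_add osub_diff osub_scale)
  have orth': "B h' h = 0" "B a h = 0" "B a h' = 0" "perp Y h" "perp Y h'"
    using orth B_commute[of a] by (simp_all add: h_def h'_def B_simps perp_add perp_diff perp_scale)
  have fh: "unit_frame (insert h Y)" "h \<notin> Y" using unit_frame_insert[OF Y(1) orth'(4) uh] .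
  show thesis
  proof (rule that[of "insert h Y" h' a])
    show "unit_frame (insert h Y)" by fact
    show "insert h Y \<subseteq> M" using hM Y by blast
    show "card (insert h Y) = n - 1" using X(3) Y fh by simp
    show "perp (insert h Y) h'" using orth' by simp
    show "perp (insert h' (insert h Y)) a" using orth' Y by simp
    fix s assume s: "I 0 s"
    show "\<not> I 1 (s * s + Q h' * Q a)"
    proof
      assume 1: "I 1 (s * s + Q h' * Q a)"
      have ut: "val_unit t"
      proof (rule ccontr)
        assume "\<not> val_unit t"
        then have "I 1 (t * t)" using t by (simp add: val_unit_iff I_square_iff)
        then have "I 1 (Q b * Q w)" using t by (simp add: I_add_cancel)
        then show False using val_unit_mult[OF b(3) w(3)] by (simp add: val_unit_iff)
      qed
      \<comment> \<open>Modulo the maximal ideal, \<open>- (Q b * Q w)\<close> is t^2 and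
        \<open>Q h\<close> is \<open>\<Delta> * Q a\<close>; this makes \<open>r\<close> a square
        root of \<open>\<Delta>\<close>.\<close>
      define r where "r = s / (t * Q a)"
      have uta: "val_unit (t * Q a)" using ut ua by (rule val_unit_mult)
      have r: "I 0 r" unfolding r_def using s uta by (rule I_divide_unit)
      have "I 1 ((t * t + Q b * Q w) * (Q h * Q a))"
        using t uh ua by (intro I_mult_right val_unit_I val_unit_mult)
      with 1 have "I 1 (s * s + Q h' * Q a - (t * t + Q b * Q w) * (Q h * Q a))" by (rule I_diff)
      then have "I 1 (s * s - t * t * (Q h * Q a))" by (simp add: Qh' algebra_simps)
      moreover have "I 1 (t * t * Q a * (Q h - \<Delta> * Q a))"
        using t xy(3) ua by (intro I_mult_left) (auto simp: Qh val_unit_I intro: I_mult_left)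
      ultimately have "I 1 (s * s - t * t * (Q h * Q a) + t * t * Q a * (Q h - \<Delta> * Q a))"
        by (rule I_add)
      also have "s * s - t * t * (Q h * Q a) + t * t * Q a * (Q h - \<Delta> * Q a) =
          (t * Q a) * ((t * Q a) * (r * r - \<Delta>))"
        using val_unit_nonzero[OF ut] val_unit_nonzero[OF ua] by (simp add: r_def field_simps)
      finally have "I 1 (r * r - \<Delta>)" using uta by (simp only: I_mult_unit_iff)
      then show False using \<Delta>(2)[OF r] by blast
    qed
  qed (use hM aM uh' ua in auto)
qed

text \<open>The n + 1 unit vectors leave a complement of rank 0 or 1. If a vector of
  \<open>K\<close> on that line were missing from \<open>M\<close>, all norms of \<open>M\<close> on
  the line would lie in the square of the maximal ideal. By anisotropy of the plane of
  \<open>b\<close> and \<open>w\<close>, the complement of \<open>X\<close> in \<open>M\<close>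
  would then represent no prime norm, against ADC.\<close>

lemma subset_if_frame_codim_1:
  assumes X: "unit_frame X" "X \<subseteq> M" "card X = n - 1"
    and b: "b \<in> M" "perp X b" "val_unit (Q b)"
    and w: "w \<in> M" "perp (insert b X) w" "val_unit (Q w)"
    and aniso: "\<And>t. I 0 t \<Longrightarrow> \<not> I 1 (t * t + Q b * Q w)"
  shows "K \<subseteq> M"
proof -
  let ?X = "insert w (insert b X)"
  have fb: "unit_frame (insert b X)" "b \<notin> X" using unit_frame_insert[OF X(1) b(2,3)] .
  have fw: "unit_frame ?X" "w \<notin> insert b X" using unit_frame_insert[OF fb(1) w(2,3)] .
  have XM: "?X \<subseteq> M" using X b w by blast
  have XV: "?X \<subseteq> V" using XM M_subset_K K_subset_V by blast
  have card: "card ?X = n + 1" using fb fw X n_ge_2 unit_frameD(2) by auto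
  have bw0: "Q b \<noteq> 0" "Q w \<noteq> 0" using b w by (simp_all add: val_unit_def)
  have orth: "B w b = 0" "B b w = 0" "perp X w" using w B_commute by auto
  have "x \<in> M" if x: "x \<in> K" "perp ?X x" for x
  proof (cases "dim V = n + 1")
    case True
    then have "x = 0" using x card XV fw K_subset_V unit_frameD(1) frame_full by (metis subsetD)
    then show ?thesis using osub_zero[OF osub_M] by simp
  next
    case False
    then have dim: "dim V = n + 2" using dim_V by simp
    have xV: "x \<in> V" using x K_subset_V by blast
    obtain k where k: "k \<in> V" "perp ?X k" "Q k \<noteq> 0" "val_unit (Q k) \<or> val_prime (Q k)"
      using frame_extend[OF unit_frameD(1)[OF fw(1)] XV] card dim by auto
    have fk: "frame (insert k ?X)" "k \<notin> ?X"
      using frame_insert[OF unit_frameD(1)[OF fw(1)] k(2,3)] .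
    have ck: "card (insert k ?X) = dim V" using fk card dim unit_frameD(2)[OF fw(1)] by simp
    have kV: "insert k ?X \<subseteq> V" using k XV by blast
    have kb: "B k b = 0" "B b k = 0" "B k w = 0" "B w k = 0" "perp X k"
      using k B_commute by auto
    have line: "u = (B u k / Q k) *s k" if "u \<in> V" "perp ?X u" for u
    proof -
      have "perp (insert k ?X) (u - (B u k / Q k) *s k)"
        using that k by (simp add: B_simps perp_diff perp_scale)
      then have "u - (B u k / Q k) *s k = 0"
        using that k subspace_V by (intro frame_full[OF fk(1) kV ck] subspace_diff subspace_scale)
      then show ?thesis by simp
    qed
    have "\<exists>u\<in>V. perp X u \<and> val_prime (Q u)"
    proof (cases "val_prime (Q k)")
      case True
      then show ?thesis using k kb by blast
    next
      case False
      then have uk: "val_unit (Q k)" using k by blast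
      \<comment> \<open>The ternary form on \<open>b, w, k\<close> has a zero modulo the maximal
        ideal with last coordinate 1.\<close>
      obtain s r where sr: "I 0 s" "I 0 r" "I 1 (Q b * (s * s) + Q w * (r * r) - - Q k)"
        using binary_form_residue_surj[OF b(3) w(3), of "- Q k"] val_unit_I[OF uk] by auto
      define u where "u = s *s b + r *s w + k"
      have u: "u \<in> V" "perp X u"
        using XV k b w orth kb subspace_V
        by (auto simp: u_def intro!: subspace_add subspace_scale perp_add perp_scale)
      have Qu: "I 1 (Q u)" using sr(3) by (simp add: u_def B_simps orth kb algebra_simps)
      show ?thesis
      proof (cases "I 2 (Q u)")
        case True
        \<comment> \<open>If the norm of \<open>u\<close> is too divisible, adding
          \<open>\<pi>\<close> times \<open>k\<close> repairs it: the norm changes by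
          \<open>\<pi> * (Q k * (2 + \<pi>))\<close>, of valuation exactly 1.\<close>
        have uk': "u + \<pi> *s k \<in> V" "perp X (u + \<pi> *s k)"
          using u k kb subspace_V by (auto intro!: subspace_add subspace_scale perp_add perp_scale)
        have "Q (u + \<pi> *s k) = Q u + \<pi> * (Q k * (2 + \<pi>))"
          by (simp add: u_def B_simps orth kb algebra_simps)
        moreover have "\<not> I 2 (\<pi> * (Q k * (2 + \<pi>)))"
          using uk val_unit_2 I_pi by (simp add: I_2_pi_iff I_mult_unit_iff val_unit_iff)
            (metis I_add_cancel I_pi add.commute)
        moreover have "I 1 (\<pi> * (Q k * (2 + \<pi>)))"
          using val_unit_I[OF uk] val_unit_I[OF val_unit_2] I_mono[OF I_pi, of 0]
          by (intro I_mult_right I_mult_left I_add) auto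
        ultimately have "val_prime (Q (u + \<pi> *s k))"
          using True Qu by (simp add: val_prime_def I_add I_add_cancel)
        then show ?thesis using uk' by blast
      next
        case False
        then show ?thesis using Qu u by (auto simp: val_prime_def)
      qed
    qed
    then obtain u where u: "u \<in> V" "perp X u" "val_prime (Q u)" by blast
    have "Q u \<noteq> 0" "I 0 (Q u)"
      using u(3) I_mono[of 1 "Q u" 0] by (auto simp: val_prime_def)
    then obtain m where m: "m \<in> M" "perp X m" "Q m = Q u"
      using adc_test[OF X u(1,2)] by metis
    define \<beta> \<gamma> where "\<beta> = B m b / Q b" and "\<gamma> = B m w / Q w"
    have bg: "I 0 \<beta>" "I 0 \<gamma>"
      using integral_sub_B[OF integral_M] m b w by (auto simp: \<beta>_def \<gamma>_def intro: I_divide_unit)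
    define m' where "m' = m - \<beta> *s b - \<gamma> *s w"
    have m': "m' \<in> M" "perp ?X m'"
      using m b w bg osub_M bw0 orth
      by (auto simp: m'_def \<beta>_def \<gamma>_def B_simps intro!: osub_diff osub_scale perp_diff perp_scale)
    have m'V: "m' \<in> V" using m' M_subset_K K_subset_V by blast
    have Qm: "Q m = Q b * (\<beta> * \<beta>) + Q w * (\<gamma> * \<gamma>) + Q m'"
    proof -
      have "m = \<beta> *s b + \<gamma> *s w + m'" by (simp add: m'_def)
      moreover have "B m' b = 0" "B b m' = 0" "B m' w = 0" "B w m' = 0" using m' B_commute by auto
      ultimately show ?thesis by (simp add: B_simps orth algebra_simps)
    qed
    show "x \<in> M"
    proof (rule ccontr)
      assume nx: "x \<notin> M"
      then have x0: "x \<noteq> 0" using osub_zero[OF osub_M] by blast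
      define c d where "c = B x k / Q k" and "d = B m' k / Q k"
      have xc: "x = c *s k" and md: "m' = d *s k"
        using line[OF xV x(2)] line[OF m'V m'(2)] by (simp_all add: c_def d_def)
      have c0: "c \<noteq> 0" using x0 xc by auto
      have mx: "m' = (d / c) *s x" using c0 by (simp add: xc md)
      \<comment> \<open>Otherwise \<open>x\<close> would be an integral multiple of
        \<open>m'\<close> and so lie in \<open>M\<close>.\<close>
      have "I 1 (d / c)"
      proof (rule ccontr)
        assume n: "\<not> I 1 (d / c)"
        then have d0: "d \<noteq> 0" by auto
        then have "I 0 (inverse (d / c))" 
          using n c0 val_inverse[of "d / c"] by (auto simp: val_ge_def)
        then have "inverse (d / c) *s m' \<in> M" using m' osub_M by (intro osub_scale)
        then show False using nx d0 c0 by (simp add: mx)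
      qed
      then have "I 2 (d / c * (d / c))" using I_mult[of 1 _ 1] by fastforce
      then have "I 2 (d / c * (d / c) * Q x)" by (rule I_mult_right) (rule Q_K[OF x(1)])
      then have Qm': "I 2 (Q m')" by (simp add: mx B_simps mult.assoc)
      have "I 1 (Q m)" "I 1 (Q m')"
        using m(3) u(3) I_mono[OF Qm', of 1] by (auto simp: val_prime_def)
      then have "I 1 (Q m - Q m')" by (rule I_diff)
      then have "I 1 (Q b * (\<beta> * \<beta>) + Q w * (\<gamma> * \<gamma>))" by (simp add: Qm)
      then have "I 1 \<beta> \<and> I 1 \<gamma>"
        using residue_anisotropic[OF b(3) w(3) aniso bg] by blast
      then have "I 2 (\<beta> * \<beta>)" "I 2 (\<gamma> * \<gamma>)"
        using I_mult[of 1 \<beta> 1 \<beta>] I_mult[of 1 \<gamma> 1 \<gamma>] by auto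
      then have "I 2 (Q m)"
        unfolding Qm using Qm' val_unit_I[OF b(3)] val_unit_I[OF w(3)]
        by (intro I_add I_mult_left[of "Q b"] I_mult_left[of "Q w"])
      then show False using m(3) u(3) by (simp add: val_prime_def)
    qed
  qed
  then show ?thesis
    using subset_if_perp_subset[OF integral_K integral_M fw(1) XM M_subset_K] by blast
qed

text \<open>A unit frame \<open>X\<close> of size \<open>n - 1\<close> is first moved into
  \<open>M\<close>. If \<open>X\<close>, or \<open>X\<close> with one more unit vector
  \<open>b\<close> of \<open>M\<close>, is saturated, then \<open>saturated_imp_subset\<close>
  applies. Otherwise ADC yields a second further unit vector in \<open>M\<close>, and the
  codimension 1 case finishes.\<close>

lemma K_subset_M: "K \<subseteq> M"
proof -
  obtain X1 where X1: "saturated X1" using saturated_exists by blast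
  then have X1': "unit_frame X1" "X1 \<subseteq> V" using K_subset_V by (auto simp: saturated_def)
  have "n - 1 \<le> card X1" using saturated_card[OF X1] dim_V by linarith
  then obtain X0 where X0: "X0 \<subseteq> X1" "card X0 = n - 1"
    using obtain_subset_with_card_n by metis
  have uX0: "unit_frame X0" "X0 \<subseteq> V"
    using X0(1) X1' finite_subset[OF X0(1)] by (auto simp: unit_frame_def frame_def subset_iff)
  \<comment> \<open>\<open>adc\<close> speaks of n vectors, so \<open>X0\<close> is completed by
    some \<open>z\<close> whose image is then discarded.\<close>
  have "card X0 < dim V" using X0 dim_V n_ge_2 by linarith
  then obtain z where z: "z \<in> V" "perp X0 z" "Q z \<noteq> 0" "val_unit (Q z) \<or> val_prime (Q z)"
    using frame_extend[OF unit_frameD(1)[OF uX0(1)] uX0(2)] by metis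
  have "I 0 (Q z)" using z(4) I_mono[of 1 "Q z" 0] by (auto simp: val_unit_iff val_prime_def)
  then obtain \<phi> where \<phi>: "\<phi> ` insert z X0 \<subseteq> M"
      "\<forall>x\<in>insert z X0. \<forall>y\<in>insert z X0. B (\<phi> x) (\<phi> y) = B x y"
    using adc[OF uX0 X0(2) z(1-3)] by blast
  define X where "X = \<phi> ` X0"
  have inj: "inj_on \<phi> X0"
  proof (rule inj_onI, rule ccontr)
    fix x y assume xy: "x \<in> X0" "y \<in> X0" "\<phi> x = \<phi> y" "x \<noteq> y"
    then have "Q x = B x y" using \<phi>(2) by (metis insertI2)
    then show False using xy uX0(1) by (auto simp: unit_frame_def frame_def)
  qed
  have X: "unit_frame X" "X \<subseteq> M" "card X = n - 1"
    using \<phi> uX0(1) X0(2) card_image[OF inj] by (auto simp: X_def unit_frame_def frame_def)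
  show ?thesis
  proof (cases "saturated X")
    case True
    show ?thesis
    proof (rule saturated_imp_subset[OF True X(2)])
      fix z assume z: "z \<in> V" "perp X z" "val_prime (Q z)"
      then have "Q z \<noteq> 0" "I 0 (Q z)" using I_mono[of 1 "Q z" 0] by (auto simp: val_prime_def)
      then obtain y where "y \<in> M" "perp X y" "Q y = Q z" using adc_test[OF X z(1,2)] by metis
      then show "\<exists>m\<in>M. perp X m \<and> I 2 (Q z - Q m)" by (intro bexI[of _ y]) auto
    qed
  next
    case False
    then obtain y where y: "y \<in> K" "perp X y" "val_unit (Q y)"
      using not_saturated X M_subset_K by blast
    then have "y \<in> V" using K_subset_V by blast
    then obtain b where b: "b \<in> M" "perp X b" "Q b = Q y"
      using adc_test[OF X _ y(2) val_unit_nonzero[OF y(3)] val_unit_I[OF y(3)]] by metis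
    have ub: "val_unit (Q b)" and b0: "Q b \<noteq> 0" using b y by (auto simp: val_unit_def)
    let ?X = "insert b X"
    have fb: "unit_frame ?X" "b \<notin> X" using unit_frame_insert[OF X(1) b(2) ub] .
    have split: "\<exists>\<beta> m'. I 0 \<beta> \<and> m' \<in> M \<and> perp ?X m' \<and> Q m = \<beta> * \<beta> * Q b + Q m'"
      if m: "m \<in> M" "perp X m" for m
    proof -
      define \<beta> where "\<beta> = B m b / Q b"
      define m' where "m' = m - \<beta> *s b"
      have \<beta>: "I 0 \<beta>" unfolding \<beta>_def using integral_sub_B[OF integral_M m(1) b(1)] ub by (rule I_divide_unit)
      have m': "m' \<in> M" "perp ?X m'"
        using m b \<beta> b0 osub_M
        by (auto simp: m'_def \<beta>_def B_simps intro!: osub_diff osub_scale perp_diff perp_scale)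
      have "m = \<beta> *s b + m'" by (simp add: m'_def)
      moreover have "B m' b = 0" "B b m' = 0" using m' B_commute by auto
      ultimately have "Q m = \<beta> * \<beta> * Q b + Q m'" by (simp add: B_simps)
      then show ?thesis using \<beta> m' by blast
    qed
    show ?thesis
    proof (cases "saturated ?X")
      case True
      show ?thesis
      proof (rule saturated_imp_subset[OF True])
        show "?X \<subseteq> M" using X b by blast
        fix z assume z: "z \<in> V" "perp ?X z" "val_prime (Q z)"
        then have "Q z \<noteq> 0" "I 0 (Q z)" "perp X z" using I_mono[of 1 "Q z" 0] by (auto simp: val_prime_def)
        then obtain y where y: "y \<in> M" "perp X y" "Q y = Q z" using adc_test[OF X z(1)] by metis
        obtain \<beta> m where m: "I 0 \<beta>" "m \<in> M" "perp ?X m" "Q y = \<beta> * \<beta> * Q b + Q m"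
          using split[OF y(1,2)] by blast
        \<comment> \<open>\<open>Q y\<close> and \<open>Q m\<close> both lie in the maximal ideal,
          hence so does \<open>\<beta>\<close>. Splitting off \<open>b\<close> therefore changes the
          norm only by an element of the square of that ideal, which the test condition
          tolerates.\<close>
        have "I 1 (Q m)" using True m M_subset_K by (auto simp: saturated_def)
        moreover have "I 1 (Q y)" using y z by (simp add: val_prime_def)
        ultimately have "I 1 (Q y - Q m)" by (intro I_diff)
        then have "I 1 (Q b * (\<beta> * \<beta>))" by (simp add: m(4) mult.commute)
        then have "I 1 \<beta>" using ub by (simp add: I_mult_unit_iff I_square_iff)
        then have "I 2 (\<beta> * \<beta>)" using I_mult[of 1 \<beta> 1 \<beta>] by simp
        then have "I 2 (Q b * (\<beta> * \<beta>))" using ub by (simp add: I_mult_unit_iff)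
        then have "I 2 (Q z - Q m)" using m(4) y(3) by (simp add: mult.commute)
        then show "\<exists>m\<in>M. perp ?X m \<and> I 2 (Q z - Q m)" using m by blast
      qed
    next
      case False
      then obtain a where a: "a \<in> K" "perp ?X a" "val_unit (Q a)"
        using not_saturated[OF fb(1)] X b M_subset_K by blast
      have aV: "a \<in> V" "b \<in> V" using a b M_subset_K K_subset_V by auto
      have orth: "B a b = 0" "B b a = 0" "perp X a" using a B_commute by auto
      obtain \<Delta> where \<Delta>: "val_unit \<Delta>" "\<And>t. I 0 t \<Longrightarrow> \<not> I 1 (t * t - \<Delta>)"
        by (rule residue_nonsquare) blast
      have ud: "val_unit (\<Delta> * Q b)" using \<Delta>(1) ub by (rule val_unit_mult)
      \<comment> \<open>\<open>u\<close> gets a norm congruent to \<open>\<Delta> * Q b\<close>. As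
        \<open>\<Delta>\<close> is not a square, a vector of \<open>M\<close> with this norm has a
        component \<open>w\<close> of unit norm orthogonal to \<open>b\<close>.\<close>
      obtain s r where sr: "I 0 s" "I 0 r" "I 1 (Q b * (s * s) + Q a * (r * r) - \<Delta> * Q b)"
        using binary_form_residue_surj[OF ub a(3), of "\<Delta> * Q b"] val_unit_I[OF ud] by auto
      define u where "u = s *s b + r *s a"
      have u: "u \<in> V" "perp X u"
        using aV b orth subspace_V by (auto simp: u_def subspace_add subspace_scale perp_add perp_scale)
      have Qu: "I 1 (Q u - \<Delta> * Q b)"
        using sr(3) by (simp add: u_def B_simps orth algebra_simps)
      then have uu: "val_unit (Q u)" using val_unit_cong[OF ud] I_diff_commute by blast
      obtain m where m: "m \<in> M" "perp X m" "Q m = Q u"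
        using adc_test[OF X u val_unit_nonzero[OF uu] val_unit_I[OF uu]] by metis
      obtain \<beta> w where w: "I 0 \<beta>" "w \<in> M" "perp ?X w" "Q m = \<beta> * \<beta> * Q b + Q w"
        using split[OF m(1,2)] by blast
      have "val_unit (Q w)"
      proof (rule ccontr)
        assume "\<not> val_unit (Q w)"
        then have "I 1 (Q w)"
          using integral_sub_B[OF integral_M w(2,2)] by (simp add: val_unit_iff)
        with Qu have "I 1 (Q u - \<Delta> * Q b - Q w)" by (rule I_diff)
        then have "I 1 (Q b * (\<beta> * \<beta> - \<Delta>))" using w(4) m(3) by (simp add: algebra_simps)
        then show False using ub \<Delta>(2)[OF w(1)] by (simp add: I_mult_unit_iff)
      qed
      then obtain X' b' w' where "unit_frame X'" "X' \<subseteq> M" "card X' = n - 1"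
        "b' \<in> M" "perp X' b'" "val_unit (Q b')"
        "w' \<in> M" "perp (insert b' X') w'" "val_unit (Q w')"
        "\<And>t. I 0 t \<Longrightarrow> \<not> I 1 (t * t + Q b' * Q w')"
        using anisotropic_completion[OF X b(1,2) ub w(2,3)] by blast
      then show ?thesis by (rule subset_if_frame_codim_1)
    qed
  qed
qed

end

section \<open>The equivalence\<close>

context quadratic_ambient
begin

lemma osub_integer_span: "osub (integer_span v (*s) S)"
  unfolding osub_def by (rule osubmodule_integer_span[OF vector_space_axioms])

lemma integral_sub_integer_span:
  assumes "\<And>s t. s \<in> S \<Longrightarrow> t \<in> S \<Longrightarrow> I 0 (B s t)"
  shows "integral_sub (integer_span v (*s) S)"
proof -
  have "I 0 (Q x)" if x: "x \<in> integer_span v (*s) S" for x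
  proof -
    have "\<forall>t\<in>S. I 0 (B x t)"
      using x by (rule integer_span_induct) (auto simp: osubmodule_def B_simps assms I_add I_mult_left)
    then have "I 0 (B y x)" if "y \<in> S" for y using that B_commute by metis
    then show ?thesis
      using integer_span_induct[OF x, of "\<lambda>y. I 0 (B y x)"]
      by (auto simp: osubmodule_def B_simps I_add I_mult_left)
  qed
  then show ?thesis by (simp add: integral_sub_def osub_integer_span)
qed

text \<open>Adjoining \<open>x\<close> to \<open>M\<close> gives an integral lattice on the same
  space. This turns maximality under inclusion into the vectorwise form that
  \<open>maximal_represents\<close> asks for.\<close>

lemma maximal_lattice_mem:
  assumes M: "lattice v (*s) M" "maximal_lattice v (*s) B M"
    and x: "x \<in> span M" "I 0 (Q x)" "\<And>m. m \<in> M \<Longrightarrow> I 0 (B x m)"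
  shows "x \<in> M"
proof -
  obtain S where S: "finite S" "M = integer_span v (*s) S" using M by (auto simp: lattice_def)
  have iM: "integral_sub M"
    using M S osub_integer_span by (simp add: integral_sub_def maximal_lattice_def norm_ideal_integral_iff)
  let ?K = "integer_span v (*s) (insert x S)"
  have SM: "S \<subseteq> M" using S integer_span_superset[OF vector_space_axioms] by simp
  have "I 0 (B m x)" if "m \<in> M" for m using x(3)[OF that] by (simp only: B_commute)
  then have "integral_sub ?K"
    using SM integral_sub_B[OF iM] x by (intro integral_sub_integer_span) (auto simp: subset_iff)
  moreover have "M \<subseteq> ?K"
    unfolding S(2) using integer_span_superset[OF vector_space_axioms, of "insert x S"]
    by (intro integer_span_minimal osubmodule_integer_span vector_space_axioms) auto
  moreover have "span ?K = span M"
    using x by (simp add: S(2) span_integer_span[OF vector_space_axioms] span_redundant)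
  moreover have "lattice v (*s) ?K" using S by (auto simp: lattice_def)
  ultimately have "?K = M"
    using M by (auto simp: maximal_lattice_def integral_sub_def norm_ideal_integral_iff)
  then show ?thesis using integer_span_superset[OF vector_space_axioms, of "insert x S"] by auto
qed

lemma maximal_lattice_imp_n_ADC:
  assumes M: "lattice v (*s) M" "maximal_lattice v (*s) B M"
  shows "n_ADC v n (*s) B M"
  unfolding n_ADC_def
proof (intro allI impI)
  fix C N
  assume h: "integral_lattice v seq_scale C N \<and> lattice_rank seq_scale N = n \<and>
    space_represents (*s) B (span M) seq_scale C (module.span seq_scale N)"
  interpret F: vector_space "seq_scale :: 'f \<Rightarrow> _" by (rule vector_space_seq_scale)
  obtain \<sigma> where \<sigma>: "Vector_Spaces.linear seq_scale (*s) \<sigma>" "\<sigma> ` F.span N \<subseteq> span M"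
    "\<forall>x\<in>F.span N. B (\<sigma> x) (\<sigma> x) = C x x"
    using h by (auto simp: space_represents_def)
  interpret \<sigma>: Vector_Spaces.linear "seq_scale :: 'f \<Rightarrow> _" "(*s)" \<sigma> by fact
  obtain S where S: "finite S" "M = integer_span v (*s) S" using M by (auto simp: lattice_def)
  obtain T where T: "finite T" "N = integer_span v seq_scale T"
    using h by (auto simp: integral_lattice_def lattice_def)
  have iM: "integral_sub M"
    using M S osub_integer_span by (simp add: integral_sub_def maximal_lattice_def norm_ideal_integral_iff)
  have N: "osubmodule seq_scale N"
    unfolding T(2) by (rule osubmodule_integer_span[OF vector_space_seq_scale])
  then have "\<sigma> 0 \<in> \<sigma> ` N" unfolding osubmodule_def by blast
  then have oN: "osub (\<sigma> ` N)"
    using N unfolding osub_def osubmodule_def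
    by (auto simp: \<sigma>.zero simp flip: \<sigma>.add \<sigma>.scale)
  moreover have "I 0 (B (\<sigma> x) (\<sigma> x))" if "x \<in> N" for x
    using h \<sigma>(3) F.span_base[OF that] that
    by (simp add: integral_lattice_def norm_ideal_integral_iff)
  ultimately have iN: "integral_sub (\<sigma> ` N)" by (auto simp: integral_sub_def)
  \<comment> \<open>Both lattices are finitely generated, so the finitely many pairings of
    generators bound all pairings.\<close>
  obtain j where j: "\<forall>(t, s) \<in> T \<times> S. I j (B (\<sigma> t) s)"
    using bounded_I[of "T \<times> S" "\<lambda>(t, s). B (\<sigma> t) s"] S T by auto
  have bdd: "I j (B (\<sigma> x) y)" if x: "x \<in> N" and y: "y \<in> M" for x y
  proof -
    have "\<forall>s\<in>S. I j (B (\<sigma> x) s)"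
      using x unfolding T(2)
      by (rule integer_span_induct)
        (use j in \<open>auto simp: osubmodule_def \<sigma>.zero \<sigma>.add \<sigma>.scale B_simps I_add I_mult_left\<close>)
    then show ?thesis
      using integer_span_induct[OF y[unfolded S(2)], of "\<lambda>y. I j (B (\<sigma> x) y)"]
      by (auto simp: osubmodule_def B_simps I_add I_mult_left)
  qed
  have "\<exists>g. Vector_Spaces.linear (*s) (*s) g \<and> g ` span M \<subseteq> span M \<and> (\<forall>x\<in>span M. Q (g x) = Q x) \<and>
      g ` \<sigma> ` N \<subseteq> M"
  proof (rule maximal_represents[where k = "card S" and j = j])
    show "finite T \<and> card T \<le> card S" if "independent T" "T \<subseteq> span M" for T
      using that S span_integer_span[OF vector_space_axioms, of S] by (intro independent_span_bound) auto
    show "\<sigma> ` N \<subseteq> span M" using \<sigma>(2) F.span_superset[of N] by blast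
    show "M \<subseteq> span M" by (rule span_superset)
    show "x \<in> M" if "x \<in> span M" "I 0 (Q x)" "\<And>m. m \<in> M \<Longrightarrow> I 0 (B x m)" for x
      using maximal_lattice_mem[OF M that] .
  qed (use iM iN bdd in auto)
  then obtain g where g: "Vector_Spaces.linear (*s) (*s) g" "g ` span M \<subseteq> span M"
      "\<forall>x\<in>span M. Q (g x) = Q x" "g ` \<sigma> ` N \<subseteq> M" by blast
  show "lattice_represents (*s) B M seq_scale C N"
    unfolding lattice_represents_def
  proof (intro exI conjI)
    show "Vector_Spaces.linear seq_scale (*s) (g \<circ> \<sigma>)"
      using Vector_Spaces.linear_compose[OF \<sigma>(1) g(1)] .
    show "(g \<circ> \<sigma>) ` F.span N \<subseteq> span M" using g \<sigma> by (auto simp: image_subset_iff)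
    show "\<forall>x\<in>F.span N. B ((g \<circ> \<sigma>) x) ((g \<circ> \<sigma>) x) = C x x"
      using g \<sigma> by (auto simp: image_subset_iff)
    show "(g \<circ> \<sigma>) ` N \<subseteq> M" using g(4) by (auto simp: image_subset_iff)
  qed
qed

text \<open>Zorn's lemma among all integral submodules between \<open>K\<close> and
  \<open>V\<close>, in place of a discriminant argument.\<close>

lemma maximal_integral_sub_exists:
  assumes "integral_sub K" "K \<subseteq> V" "subspace V"
  obtains L where "integral_sub L" "K \<subseteq> L" "L \<subseteq> V"
    "\<And>x. x \<in> V \<Longrightarrow> I 0 (Q x) \<Longrightarrow> (\<And>k. k \<in> L \<Longrightarrow> I 0 (B x k)) \<Longrightarrow> x \<in> L"
proof -
  let ?A = "{L. integral_sub L \<and> K \<subseteq> L \<and> L \<subseteq> V}"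
  have "\<exists>L\<in>?A. \<forall>X\<in>?A. L \<subseteq> X \<longrightarrow> X = L"
  proof (rule subset_Zorn_nonempty)
    show "?A \<noteq> {}" using assms by blast
    fix \<C> assume C: "\<C> \<noteq> {}" "subset.chain ?A \<C>"
    have sub: "integral_sub L" "K \<subseteq> L" "L \<subseteq> V" if "L \<in> \<C>" for L
      using C(2) that by (auto simp: subset_chain_def)
    have osub: "osub L" if "L \<in> \<C>" for L using sub(1)[OF that] by (simp add: integral_sub_def)
    have "osub (\<Union>\<C>)"
      unfolding osub_def osubmodule_def
    proof (intro conjI ballI allI impI)
      show "0 \<in> \<Union>\<C>" using C(1) osub osub_zero by blast
      show "c *s x \<in> \<Union>\<C>" if "I 0 c" "x \<in> \<Union>\<C>" for c x
        using that osub osub_scale by blast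
      fix x y assume "x \<in> \<Union>\<C>" "y \<in> \<Union>\<C>"
      then obtain X Y where XY: "X \<in> \<C>" "Y \<in> \<C>" "x \<in> X" "y \<in> Y" by blast
      then have "X \<subseteq> Y \<or> Y \<subseteq> X" using C(2) unfolding subset_chain_def by blast
      then show "x + y \<in> \<Union>\<C>" using XY osub osub_add by blast
    qed
    then have "integral_sub (\<Union>\<C>)" using sub(1) by (auto simp: integral_sub_def)
    moreover have "K \<subseteq> \<Union>\<C>" "\<Union>\<C> \<subseteq> V" using C(1) sub(2,3) by blast+
    ultimately show "\<Union>\<C> \<in> ?A" by blast
  qed
  then obtain L where LA: "L \<in> ?A" "\<forall>X\<in>?A. L \<subseteq> X \<longrightarrow> X = L" ..
  then have L: "integral_sub L" "K \<subseteq> L" "L \<subseteq> V" by auto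
  have max: "X = L" if "integral_sub X" "X \<subseteq> V" "L \<subseteq> X" for X
    using LA(2) L(2) that by auto
  have "x \<in> L" if x: "x \<in> V" "I 0 (Q x)" "\<And>k. k \<in> L \<Longrightarrow> I 0 (B x k)" for x
  proof -
    let ?X = "integer_span v (*s) (insert x L)"
    have sup: "insert x L \<subseteq> ?X" by (rule integer_span_superset[OF vector_space_axioms])
    have "I 0 (B m x)" if "m \<in> L" for m using x(3)[OF that] by (simp only: B_commute)
    then have "integral_sub ?X"
      using x L integral_sub_B[OF L(1)] by (intro integral_sub_integer_span) auto
    moreover have "?X \<subseteq> V"
      using x L assms(3) by (intro integer_span_minimal) (auto simp: osubmodule_def subspace_def)
    ultimately have "?X = L" using max sup by blast
    then show ?thesis using sup by blast
  qed
  then show thesis using that L by blast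
qed

text \<open>Supplies the hypothesis of \<open>adc_pair\<close>. The frame generates an integral
  lattice of rank n whose space is represented by inclusion, and \<open>n_ADC_represents\<close>
  lets it live in the ambient space of \<open>M\<close>.\<close>

lemma n_ADC_unit_frame:
  assumes "n_ADC v n (*s) B M"
    and X: "unit_frame X" "X \<subseteq> span M" "card X = n - 1" "0 < n"
    and z: "z \<in> span M" "perp X z" "Q z \<noteq> 0" "I 0 (Q z)"
  shows "\<exists>\<phi>. \<phi> ` insert z X \<subseteq> M \<and> (\<forall>x\<in>insert z X. \<forall>y\<in>insert z X. B (\<phi> x) (\<phi> y) = B x y)"
proof -
  define Y where "Y = insert z X"
  have Y: "frame Y" "z \<notin> X" unfolding Y_def using frame_insert[OF unit_frameD(1)[OF X(1)] z(2,3)] .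
  have finY: "finite Y" using Y by (simp add: frame_def)
  have QY: "I 0 (Q y)" if "y \<in> Y" for y
    using that X z by (auto simp: Y_def unit_frame_def val_unit_I)
  define N where "N = integer_span v (*s) Y"
  have spanN: "span N = span Y" unfolding N_def by (rule span_integer_span[OF vector_space_axioms])
  have iN: "integral_sub N"
    unfolding N_def
  proof (rule integral_sub_integer_span)
    show "I 0 (B s t)" if "s \<in> Y" "t \<in> Y" for s t
      using Y(1) that QY by (cases "s = t") (auto simp: frame_def)
  qed
  have "quadratic_space (*s) B (span N)"
    unfolding quadratic_space_def spanN
    by (intro conjI exI[of _ Y] ballI allI finY vector_space_axioms B_commute B_add_left B_scale_left refl)
  moreover have "nondegenerate B (span N)"
    unfolding nondegenerate_def spanN using span_frame_perp[OF Y(1)] span_base by (auto simp: perp_def)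
  ultimately have "integral_lattice v (*s) B N"
    using iN finY by (auto simp: integral_lattice_def lattice_def N_def norm_ideal_integral_iff integral_sub_def)
  moreover have "lattice_rank (*s) N = n"
    using dim_eq_card_independent[OF frame_independent[OF Y(1)]] X Y unit_frameD(2)[OF X(1)]
    by (simp add: lattice_rank_def spanN) (simp add: Y_def)
  moreover have sub: "span N \<subseteq> span M"
    unfolding spanN using X z by (intro span_minimal) (auto simp: Y_def)
  then have "space_represents (*s) B (span M) (*s) B (span N)"
    unfolding space_represents_def by (intro exI[of _ "\<lambda>x. x"]) (auto intro: linearI)
  ultimately have "lattice_represents (*s) B M (*s) B N"
    by (rule n_ADC_represents[OF assms(1)])
  then obtain \<sigma> where \<sigma>: "Vector_Spaces.linear (*s) (*s) \<sigma>" "\<forall>x\<in>span N. Q (\<sigma> x) = Q x" "\<sigma> ` N \<subseteq> M"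
    by (auto simp: lattice_represents_def)
  have YN: "Y \<subseteq> N" unfolding N_def by (rule integer_span_superset[OF vector_space_axioms])
  \<comment> \<open>A representation is only known to preserve \<open>Q\<close>; polarization
    recovers \<open>B\<close>, since 2 is nonzero.\<close>
  have "B (\<sigma> x) (\<sigma> y) = B x y" if "x \<in> Y" "y \<in> Y" for x y
  proof -
    have "x \<in> span N" "y \<in> span N" using that YN span_base by auto
    then have "2 * B (\<sigma> x) (\<sigma> y) = 2 * B x y"
      using \<sigma>(2) span_add by (simp add: polarization flip: linear_addD[OF \<sigma>(1)])
    then show ?thesis by simp
  qed
  then show ?thesis using \<sigma>(3) YN unfolding Y_def by blast
qed

text \<open>A competitor \<open>K\<close> is enlarged to a maximal integral submodule
  \<open>L\<close>, as \<open>adc_pair\<close> requires, and \<open>L\<close> then lies in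
  \<open>M\<close>.\<close>

lemma n_ADC_imp_maximal_lattice:
  assumes "2 \<le> n" and M: "integral_lattice v (*s) B M"
    and rank: "lattice_rank (*s) M = n + 1 \<or> lattice_rank (*s) M = n + 2"
    and ADC: "n_ADC v n (*s) B M"
  shows "maximal_lattice v (*s) B M"
  unfolding maximal_lattice_def
proof (intro conjI allI impI)
  show "norm_ideal v B M \<subseteq> ring_of_integers v" using M by (simp add: integral_lattice_def)
  fix K assume K: "lattice v (*s) K \<and> span K = span M \<and> norm_ideal v B K \<subseteq> ring_of_integers v \<and> M \<subseteq> K"
  have "osub M" "osub K"
    using M K osub_integer_span by (auto simp: integral_lattice_def lattice_def)
  then have iM: "integral_sub M" and iK: "integral_sub K"
    using M K by (auto simp: integral_sub_def integral_lattice_def norm_ideal_integral_iff)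
  have "K \<subseteq> span M" using K span_superset by blast
  then obtain L where L: "integral_sub L" "K \<subseteq> L" "L \<subseteq> span M"
      "\<And>x. x \<in> span M \<Longrightarrow> I 0 (Q x) \<Longrightarrow> (\<And>k. k \<in> L \<Longrightarrow> I 0 (B x k)) \<Longrightarrow> x \<in> L"
    using maximal_integral_sub_exists[OF iK _ subspace_span] by metis
  interpret adc_pair v "(*s)" B "span M" M L n
  proof unfold_locales
    show "\<exists>S. finite S \<and> span M = span S" "nondegenerate B (span M)"
      using M by (auto simp: integral_lattice_def quadratic_space_def)
    show "dim (span M) = n + 1 \<or> dim (span M) = n + 2" using rank by (simp add: lattice_rank_def)
    show "M \<subseteq> L" using K L by blast
    show "x \<in> L" if "x \<in> span M" "I 0 (Q x)" "\<And>k. k \<in> L \<Longrightarrow> I 0 (B x k)" for x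
      using L(4)[OF that] .
    show "\<exists>\<phi>. \<phi> ` insert z X \<subseteq> M \<and> (\<forall>x\<in>insert z X. \<forall>y\<in>insert z X. B (\<phi> x) (\<phi> y) = B x y)"
      if "unit_frame X" "X \<subseteq> span M" "card X = n - 1" "z \<in> span M" "perp X z" "Q z \<noteq> 0" "I 0 (Q z)"
      for X z
      using n_ADC_unit_frame[OF ADC that(1-3) _ that(4-)] assms(1) by auto
  qed (use assms iM L in auto)
  show "K = M" using K_subset_M L K by blast
qed

end

text \<open>Only the values \<open>B x x\<close> on \<open>FM\<close> enter, so the form may be
  replaced by one that agrees with it there.\<close>

lemma n_ADC_cong:
  assumes "\<And>x. x \<in> module.span scale M \<Longrightarrow> B x x = B' x x"
  shows "n_ADC v n scale B M \<longleftrightarrow> n_ADC v n scale B' M"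
proof -
  have "space_represents scale B (module.span scale M) seq_scale C W \<longleftrightarrow>
      space_represents scale B' (module.span scale M) seq_scale C W" for C W
    unfolding space_represents_def using assms by (metis image_subset_iff)
  moreover have "lattice_represents scale B M seq_scale C N \<longleftrightarrow> lattice_represents scale B' M seq_scale C N"
    for C N
    unfolding lattice_represents_def using assms by (metis image_subset_iff)
  ultimately show ?thesis unfolding n_ADC_def by simp
qed

lemma norm_ideal_cong:
  assumes "\<And>x. x \<in> K \<Longrightarrow> B x x = B' x x"
  shows "norm_ideal v B K = norm_ideal v B' K"
proof -
  have "{B x x |x. x \<in> K} = {B' x x |x. x \<in> K}" using assms by force
  then show ?thesis by (simp add: norm_ideal_def)
qed

lemma maximal_lattice_cong:
  assumes "vector_space scale" and eq: "\<And>x. x \<in> module.span scale M \<Longrightarrow> B x x = B' x x"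
  shows "maximal_lattice v scale B M \<longleftrightarrow> maximal_lattice v scale B' M"
proof -
  interpret vector_space scale by fact
  have "norm_ideal v B K = norm_ideal v B' K" if "span K = span M" for K
    using that eq span_base by (intro norm_ideal_cong) auto
  then show ?thesis unfolding maximal_lattice_def by (simp cong: conj_cong)
qed

theorem theorem2p11:
  fixes v :: "'f::field \<Rightarrow> int"
    and n :: nat
    and scale :: "'f \<Rightarrow> 'v::ab_group_add \<Rightarrow> 'v"
    and B :: "'v \<Rightarrow> 'v \<Rightarrow> 'f"
    and M :: "'v set"
  assumes "nonarch_local_field v"
    and "non_dyadic v"
    and "n \<ge> 2"
    and "integral_lattice v scale B M"
    and "lattice_rank scale M = n + 1 \<or> lattice_rank scale M = n + 2"
  shows "n_ADC v n scale B M \<longleftrightarrow> maximal_lattice v scale B M"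
proof -
  have qs: "quadratic_space scale B (module.span scale M)"
    using assms(4) by (simp add: integral_lattice_def)
  then have vs: "vector_space scale" by (simp add: quadratic_space_def)
  interpret vector_space scale by (rule vs)
  interpret pair: vector_space_pair scale scale ..
  have "Vector_Spaces.linear scale scale (\<lambda>x. x)"
    using vs by (simp add: Vector_Spaces.linear_iff)
  \<comment> \<open>\<open>p\<close> projects linearly onto \<open>FM\<close>. The form pulled back
    along \<open>p\<close> is symmetric and bilinear everywhere and unchanged on \<open>FM\<close>,
    as \<open>quadratic_ambient\<close> demands.\<close>
  then obtain p where p: "range p \<subseteq> span M" "Vector_Spaces.linear scale scale p" "\<forall>x\<in>span M. p x = x"
    using pair.linear_exists_left_inverse_on[of "\<lambda>x. x" "span M"] subspace_span by auto
  have p_add: "p (x + y) = p x + p y" and p_scale: "p (scale c x) = scale c (p x)" for x y c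
    using p(2) by (simp_all add: Vector_Spaces.linear_iff)
  have pM: "p x \<in> span M" for x using p(1) by blast
  define B' where "B' x y = B (p x) (p y)" for x y
  have eq: "B' x y = B x y" if "x \<in> span M" "y \<in> span M" for x y
    using that p(3) by (simp add: B'_def)
  interpret nonarch_local_field v by fact
  interpret quadratic_ambient v scale B'
  proof unfold_locales
    show "non_dyadic v" by fact
    show "B' x y = B' y x" "B' (x + y) z = B' x z + B' y z" "B' (scale c x) y = c * B' x y" for x y z c
      using qs pM unfolding B'_def p_add p_scale quadratic_space_def by blast+
  qed
  have "quadratic_space scale B' (span M)"
    using qs unfolding quadratic_space_def by (auto simp: eq span_add span_scale)
  moreover have "nondegenerate B' (span M)"
    using assms(4) eq by (simp add: integral_lattice_def nondegenerate_def)
  moreover have "norm_ideal v B' M = norm_ideal v B M"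
    using eq span_base by (intro norm_ideal_cong) auto
  ultimately have "integral_lattice v scale B' M"
    using assms(4) by (simp add: integral_lattice_def)
  then have "n_ADC v n scale B' M \<longleftrightarrow> maximal_lattice v scale B' M"
    using maximal_lattice_imp_n_ADC n_ADC_imp_maximal_lattice[OF assms(3) _ assms(5)]
    by (auto simp: integral_lattice_def)
  moreover have "n_ADC v n scale B' M \<longleftrightarrow> n_ADC v n scale B M"
    using eq by (intro n_ADC_cong)
  moreover have "maximal_lattice v scale B' M \<longleftrightarrow> maximal_lattice v scale B M"
    using eq by (intro maximal_lattice_cong[OF vs])
  ultimately show ?thesis by blast
qed

end
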